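(* Let $\Omega\subset\mathbb{C}$ be a bounded John domain, let $z_0\in\Omega$, let $1<p<\infty$, and let $\alpha\in\mathbb{R}$ satisfy $\alpha>\dim_{\mathrm A}(\partial\Omega)-2$. Then there is a constant $C\ge 1$, depending only on $\Omega,p,\alpha$ and $z_0$, such that every analytic function $g$ in $\Omega$ satisfies $$ C^{-1}\int_\Omega |g(z)|^p\delta(z)^\alpha\,dA(z) \le |g(z_0)|^p\delta(z_0)^{\alpha+2}+\int_\Omega |g'(z)|^p\delta(z)^{\alpha+p}\,dA(z) \le C\int_\Omega |g(z)|^p\delta(z)^\alpha\,dA(z). $$
   Context: $\delta(z)=\operatorname{dist}(z,\partial\Omega)$ is the Euclidean distance to the boundary and $dA=dx\,dy$ is Euclidean area measure. A domain is a nonempty connected open set. Inequalities involving possibly infinite integrals are understood in the extended sense (values in $[0,\infty]$). John domain: a bounded domain $\Omega\subset\mathbb{C}$ is a John domain if there exist a point $x_0\in\Omega$ and a constant $C_J>0$ such that every $x\in\Omega$ can be joined to $x_0$ by a rectifiable curve $\gamma:[0,\ell]\to\Omega$, parametrized by arclength starting from $x$ (so $\gamma(0)=x$, $\gamma(\ell)=x_0$), with $\delta(\gamma(t))\ge C_J t$ for $0\le t\le \ell$. Assouad dimension: for $E\subset\mathbb{C}$, $\dim_{\mathrm A}(E)$ is the infimum of all exponents $s\ge0$ for which there is a constant $C>0$ such that $N_r(E\cap B(x,R))\le C(R/r)^s$ for all $x\in E$ and all $0<r<R$, where $B(x,R)$ is the open ball and $N_r(A)$ is the smallest number of open balls of radius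 $r$ needed to cover $A$. *)

theory Defs
  imports "HOL-Analysis.Analysis"
begin

definition bdry_dist :: "complex set \<Rightarrow> complex \<Rightarrow> real" where
  "bdry_dist \<Omega> z = infdist z (frontier \<Omega>)"

definition complex_domain :: "complex set \<Rightarrow> bool" where
  "complex_domain \<Omega> \<longleftrightarrow> open \<Omega> \<and> connected \<Omega> \<and> \<Omega> \<noteq> {}"

text \<open>The length of the restriction of \<open>\<gamma>\<close> to \<open>{a..b}\<close> for \<open>a \<le> b\<close>: the supremum of the
  lengths of the inscribed polygons over all partitions \<open>a = t 0 \<le> \<dots> \<le> t n = b\<close>.\<close>

definition curve_length :: "(real \<Rightarrow> complex) \<Rightarrow> real \<Rightarrow> real \<Rightarrow> ennreal" where
  "curve_length \<gamma> a b =
     (SUP (n, t) \<in> {(n :: nat, t :: nat \<Rightarrow> real). t 0 = a \<and> t n = b \<and> mono_on {..n} t}.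
        ennreal (\<Sum>i<n. dist (\<gamma> (t i)) (\<gamma> (t (Suc i)))))"

text \<open>Rectifiability is implied by the second conjunct, since the total length is \<open>l < \<infinity>\<close>.
  The degenerate case \<open>l = 0\<close> is a constant curve.\<close>

definition arclength_curve :: "(real \<Rightarrow> complex) \<Rightarrow> real \<Rightarrow> bool" where
  "arclength_curve \<gamma> l \<longleftrightarrow>
     0 \<le> l \<and> continuous_on {0..l} \<gamma> \<and> (\<forall>t\<in>{0..l}. curve_length \<gamma> 0 t = ennreal t)"

definition john_domain :: "complex set \<Rightarrow> bool" where
  "john_domain \<Omega> \<longleftrightarrow>
     complex_domain \<Omega> \<and> bounded \<Omega> \<and>
     (\<exists>x0\<in>\<Omega>. \<exists>CJ>0. \<forall>x\<in>\<Omega>. \<exists>\<gamma> l.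
        arclength_curve \<gamma> l \<and> \<gamma> ` {0..l} \<subseteq> \<Omega> \<and> \<gamma> 0 = x \<and> \<gamma> l = x0 \<and>
        (\<forall>t\<in>{0..l}. bdry_dist \<Omega> (\<gamma> t) \<ge> CJ * t))"

text \<open>The centres of the covering balls are arbitrary points of the plane; the value is \<open>\<infinity>\<close>
  if there is no finite cover.\<close>

definition covering_number :: "real \<Rightarrow> complex set \<Rightarrow> enat" where
  "covering_number r A = (INF F \<in> {F. finite F \<and> A \<subseteq> (\<Union>c\<in>F. ball c r)}. enat (card F))"

definition assouad_dim :: "complex set \<Rightarrow> ereal" where
  "assouad_dim E =
     (INF s \<in> {s :: real. 0 \<le> s \<and>
          (\<exists>C>0. \<forall>x\<in>E. \<forall>r R. 0 < r \<and> r < R \<longrightarrow>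
             ereal_of_enat (covering_number r (E \<inter> ball x R)) \<le> ereal (C * (R / r) powr s))}.
        ereal s)"

end

(* The upper estimate is the sub-mean value property of |g|^p on discs of radius comparable to the
   distance to the boundary, integrated over the domain.

   For the lower estimate no Whitney decomposition is needed.  Along the John curve from x, the
   distance to the boundary at time t dominates t + dist(x), up to a constant.  Hoelder's inequality
   with the weight (t + dist(x))^(-1-kappa/(p-1)), followed by the sub-mean value property of |g'|^p,
   bounds |g(x) - g(x0)|^p by dist(x)^(-kappa) times the integral of |g'|^p dist^(p-2+kappa) over those
   z with |x - z| <= M dist(z).  By Tonelli's theorem it remains to integrate dist^(alpha-kappa) over
   the shadow of z, that is over the x with |x - z| <= M dist(z).  For small kappa this is at most a
   constant times dist(z)^(alpha-kappa+2): split the shadow into dyadic layers and cover each layer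
   according to the Assouad dimension of the boundary. *)

theory Submission
  imports Defs "HOL-Complex_Analysis.Cauchy_Integral_Formula"
begin

subsection \<open>Power functions\<close>

text \<open>The exponent kappa answers an endpoint failure: for kappa = 0 the Hoelder weight is 1/(t
  + dist(x)), whose integral along the curve is a logarithm, with no bound uniform in x. Any kappa >
  0 turns it into the power dist(x)^(-kappa/(p-1)). The loss is paid for by the strict inequality
  between dimension and alpha + 2: for sigma strictly between them, kappa = alpha + 2 - sigma leaves
  the weight exponent alpha - kappa = sigma - 2 admissible for the boundary. In the end kappa
  cancels, since p - 2 + kappa and alpha - kappa + 2 add up to alpha + p.

  A second obstacle is that the John curves end at a centre x0, while the estimate is normalised at
  an arbitrary z0. The difference g(x0) - g(z0) is controlled by the same curve estimate, started at
  z0. The points z that enter it satisfy |z0 - z| <= M dist(z); they stay away from the boundary, so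
  all powers of dist(z) are comparable there.

  The integrals may be infinite, so the main estimates are inequalities in
  \<open>ennreal\<close>.\<close>

lemma powr_comparable:
  fixes a b M e :: real
  assumes "0 < a" "0 < b" "a \<le> M * b" "b \<le> M * a"
  shows "a powr e \<le> M powr \<bar>e\<bar> * b powr e"
proof -
  have M: "M > 0"
    using assms by (metis less_le_trans zero_less_mult_pos2)
  \<comment> \<open>The first comparison serves \<open>e >= 0\<close>, the second
    \<open>e < 0\<close>; the exponent \<open>\<bar>e\<bar>\<close> lets both signs share one
    formula.\<close>
  show ?thesis
  proof (cases "e \<ge> 0")
    case True
    then have "a powr e \<le> (M * b) powr e"
      using assms by (intro powr_mono2) auto
    then show ?thesis
      using True M assms by (simp add: powr_mult)
  next
    case False
    have "a powr e \<le> (b / M) powr e"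
      using False assms M by (intro powr_mono2') (auto simp: field_simps)
    also have "\<dots> = M powr \<bar>e\<bar> * b powr e"
      using False M assms by (simp add: powr_divide powr_minus field_simps)
    finally show ?thesis .
  qed
qed

lemma powr_add3_le:
  fixes a b c p :: real
  assumes "0 \<le> a" "0 \<le> b" "0 \<le> c" "0 \<le> p"
  shows "(a + b + c) powr p \<le> 3 powr p * (a powr p + b powr p + c powr p)"
proof -
  define m where "m = max a (max b c)"
  have m: "m \<ge> 0" "a + b + c \<le> 3 * m"
    using assms by (auto simp: m_def)
  have "(a + b + c) powr p \<le> (3 * m) powr p"
    using assms m by (intro powr_mono2) auto
  also have "\<dots> = 3 powr p * m powr p"
    using m by (simp add: powr_mult)
  also have "m powr p \<le> a powr p + b powr p + c powr p"
    by (auto simp: m_def max_def)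
  finally show ?thesis by simp
qed

text \<open>By convexity the graph of the p-th power lies above its tangent at \<open>m\<close>;
  written out, this is Young's inequality with exponents \<open>p\<close> and
  \<open>p / (p - 1)\<close>. It is the pointwise form of the Hoelder inequality that
  follows.\<close>

lemma powr_above_tangent:
  fixes s m p :: real
  assumes "1 < p" "0 \<le> s" "0 \<le> m"
  shows "m powr p + p * m powr (p - 1) * (s - m) \<le> s powr p"
proof (cases "m = 0")
  case False
  define q where "q = p / (p - 1)"
  have q: "q > 1" "1 / p + 1 / q = 1" "(p - 1) * q = p"
    using assms by (auto simp: q_def field_simps)
  have "s * m powr (p - 1) \<le> s powr p / p + (m powr (p - 1)) powr q / q"
    using assms q by (intro Youngs_inequality) auto
  also have "(m powr (p - 1)) powr q = m powr p"
    using q by (simp add: powr_powr)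
  finally have "p * (s * m powr (p - 1)) \<le> p * (s powr p / p + m powr p / q)"
    using assms by (intro mult_left_mono) auto
  also have "\<dots> = s powr p + (p - 1) * m powr p"
    using assms by (simp add: q_def field_simps)
  finally have "p * (s * m powr (p - 1)) \<le> s powr p + (p - 1) * m powr p" .
  moreover have "m powr (p - 1) * m = m powr p"
    using False assms powr_add[of m "p - 1" 1] by simp
  ultimately show ?thesis by (simp add: algebra_simps)
qed (use assms in auto)

text \<open>Hoelder's inequality in Jensen's form: the tangent inequality is applied to the ratio
  \<open>u / v\<close> and integrated against \<open>v\<close>. The free weight \<open>v\<close> is
  what later allows a power of the arclength to be inserted.\<close>

lemma weighted_power_mean:
  fixes u v :: "real \<Rightarrow> real"
  assumes p: "1 < p" and ab: "a < b"
    and cu: "continuous_on {a..b} u" and cv: "continuous_on {a..b} v"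
    and u: "\<And>t. t \<in> {a..b} \<Longrightarrow> 0 \<le> u t" and v: "\<And>t. t \<in> {a..b} \<Longrightarrow> 0 < v t"
  shows "integral {a..b} u powr p
           \<le> integral {a..b} v powr (p - 1) * integral {a..b} (\<lambda>t. u t powr p * v t powr (1 - p))"
proof -
  define U where "U = integral {a..b} u"
  define V where "V = integral {a..b} v"
  have iu: "u integrable_on {a..b}" and iv: "v integrable_on {a..b}"
    using cu cv by (auto intro: integrable_continuous_real)
  have "\<forall>t\<in>{a..b}. 0 \<le> v t \<and> v t \<noteq> 0"
    using v by (metis less_le)
  then have cw: "continuous_on {a..b} (\<lambda>t. u t powr p * v t powr (1 - p))"
    using p u by (intro continuous_on_mult continuous_on_powr' cu cv continuous_on_const) auto
  have U: "U \<ge> 0" unfolding U_def using u by (intro integral_nonneg iu) auto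
  \<comment> \<open>Compactness gives \<open>v\<close> a positive minimum, hence
    \<open>V > 0\<close>, and division by \<open>V\<close> is meaningful.\<close>
  obtain t0 where t0: "t0 \<in> {a..b}" "\<And>t. t \<in> {a..b} \<Longrightarrow> v t0 \<le> v t"
    using continuous_attains_inf[of "{a..b}" v] ab cv by auto
  have "integral {a..b} (\<lambda>_. v t0) \<le> V"
    unfolding V_def using t0 by (intro integral_le iv) auto
  then have "v t0 * (b - a) \<le> V" using ab by (simp add: mult.commute)
  then have V: "V > 0"
    using ab v[OF t0(1)] by (smt (verit) mult_pos_pos)
  \<comment> \<open>This is the mean of \<open>u / v\<close> with respect to \<open>v dt\<close>;
    with this point of tangency the linear term integrates to zero.\<close>
  define m where "m = U / V"
  have m: "m \<ge> 0" using U V by (simp add: m_def)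
  have pt: "m powr p * v t + p * m powr (p - 1) * (u t - m * v t) \<le> u t powr p * v t powr (1 - p)"
    if t: "t \<in> {a..b}" for t
  proof -
    have vt: "v t > 0" and ut: "u t \<ge> 0" using u v t by auto
    have "(m powr p + p * m powr (p - 1) * (u t / v t - m)) * v t \<le> (u t / v t) powr p * v t"
      using p vt ut m by (intro mult_right_mono powr_above_tangent) auto
    also have "\<dots> = u t powr p * v t powr (1 - p)"
      using vt ut by (simp add: powr_divide powr_diff)
    finally have "(m powr p + p * m powr (p - 1) * (u t / v t - m)) * v t \<le> u t powr p * v t powr (1 - p)" .
    moreover have "(m powr p + p * m powr (p - 1) * (u t / v t - m)) * v t
        = m powr p * v t + p * m powr (p - 1) * (u t - m * v t)"
      using vt by (simp add: distrib_right left_diff_distrib right_diff_distrib)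
    ultimately show ?thesis by simp
  qed
  have "((\<lambda>t. m powr p * v t + p * m powr (p - 1) * (u t - m * v t)) has_integral
          (m powr p * V + p * m powr (p - 1) * (U - m * V))) {a..b}"
    unfolding U_def V_def
    by (intro has_integral_add has_integral_diff has_integral_mult_right integrable_integral iu iv)
  moreover have "U - m * V = 0" using V by (simp add: m_def)
  ultimately have "((\<lambda>t. m powr p * v t + p * m powr (p - 1) * (u t - m * v t)) has_integral
          m powr p * V) {a..b}" by simp
  then have "m powr p * V \<le> integral {a..b} (\<lambda>t. u t powr p * v t powr (1 - p))"
    by (rule has_integral_le[OF _ integrable_integral[OF integrable_continuous_real[OF cw]]])
      (use pt in auto)
  then have "V powr (p - 1) * (m powr p * V)
      \<le> V powr (p - 1) * integral {a..b} (\<lambda>t. u t powr p * v t powr (1 - p))"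
    by (rule mult_left_mono) simp
  moreover have "V powr (p - 1) * (m powr p * V) = U powr p"
    using V U by (simp add: m_def powr_divide powr_diff)
  ultimately show ?thesis by (simp add: U_def V_def)
qed

text \<open>Bridge from the gauge integral, in which the estimates along curves are made, to the
  nonnegative Lebesgue integral, in which the order of integration is exchanged.\<close>

lemma nn_integral_continuous_on_Icc:
  fixes f :: "real \<Rightarrow> real"
  assumes "continuous_on {a..b} f" "\<And>t. t \<in> {a..b} \<Longrightarrow> 0 \<le> f t"
  shows "(\<integral>\<^sup>+t\<in>{a..b}. ennreal (f t) \<partial>lborel) = ennreal (integral {a..b} f)"
proof -
  have eq: "indicator {a..b} t * f t = (if t \<in> {a..b} then f t else 0)" for t
    by simp
  have "((\<lambda>t. indicator {a..b} t * f t) has_integral integral {a..b} f) UNIV"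
    unfolding eq has_integral_restrict_UNIV
    by (intro integrable_integral integrable_continuous_real assms)
  then have "(\<integral>\<^sup>+t. ennreal (indicator {a..b} t * f t) \<partial>lborel) = ennreal (integral {a..b} f)"
    using assms borel_measurable_continuous_on_indicator[OF _ assms(1)]
    by (intro nn_integral_has_integral_lborel) (auto simp: indicator_def)
  moreover have "(\<integral>\<^sup>+t\<in>{a..b}. ennreal (f t) \<partial>lborel) = (\<integral>\<^sup>+t. ennreal (indicator {a..b} t * f t) \<partial>lborel)"
    by (intro nn_integral_cong) (simp split: split_indicator)
  ultimately show ?thesis by simp
qed

lemma emeasure_ball_complex:
  assumes "0 \<le> r"
  shows "emeasure lborel (ball (z :: complex) r) = ennreal (pi * r\<^sup>2)"
  using assms by (simp add: emeasure_ball eval_unit_ball_vol)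

text \<open>Cauchy's formula for \<open>f z\<close> on a circle of radius \<open>\<rho>\<close> that
  is centred at \<open>z + w\<close> instead of \<open>z\<close>. Since
  \<open>norm w < \<rho> / 2\<close>, the circle stays at distance at least
  \<open>\<rho> / 2\<close> from \<open>z\<close>, so the Cauchy kernel costs only the factor 2,
  uniformly in the shift \<open>w\<close>.\<close>

lemma norm_le_integral_circlepath:
  fixes f :: "complex \<Rightarrow> complex"
  assumes f: "f holomorphic_on ball z (2 * \<rho>)" and \<rho>: "0 < \<rho>" and w: "norm w < \<rho> / 2"
  shows "norm (f z) \<le> 2 * integral {0..1} (\<lambda>t. norm (f (circlepath (z + w) \<rho> t)))"
    and "continuous_on {0..1} (\<lambda>t. norm (f (circlepath (z + w) \<rho> t)))"
proof -
  have sub: "cball (z + w) \<rho> \<subseteq> ball z (2 * \<rho>)"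
  proof
    fix y assume "y \<in> cball (z + w) \<rho>"
    then have "norm (z + w - y) \<le> \<rho>" by (simp add: dist_norm)
    then have "norm ((z + w - y) - w) \<le> \<rho> + \<rho> / 2"
      using norm_triangle_ineq4[of "z + w - y" w] w by linarith
    then show "y \<in> ball z (2 * \<rho>)" using \<rho> by (simp add: dist_norm)
  qed
  have cont: "continuous_on (cball (z + w) \<rho>) f"
    using f sub holomorphic_on_imp_continuous_on holomorphic_on_subset by blast
  have circ: "norm (circlepath (z + w) \<rho> t - (z + w)) = \<rho>" for t
    using \<rho> by (simp add: circlepath norm_mult norm_exp_eq_Re)
  have "continuous_on {0..1} (f \<circ> circlepath (z + w) \<rho>)"
  proof (rule continuous_on_compose)
    show "continuous_on {0..1} (circlepath (z + w) \<rho>)"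
      by (metis path_circlepath path_def)
    show "continuous_on (circlepath (z + w) \<rho> ` {0..1}) f"
      using circ by (intro continuous_on_subset[OF cont]) (auto simp: dist_norm norm_minus_commute)
  qed
  then show c2: "continuous_on {0..1} (\<lambda>t. norm (f (circlepath (z + w) \<rho> t)))"
    by (intro continuous_intros) (simp add: o_def)
  have "((\<lambda>u. f u / (u - z)) has_contour_integral (2 * of_real pi * \<i> * f z)) (circlepath (z + w) \<rho>)"
    using cont f w \<rho>
    by (intro Cauchy_integral_circlepath) (auto intro: holomorphic_on_subset[OF _ order_trans[OF ball_subset_cball sub]])
  then have hi: "((\<lambda>t. f (circlepath (z + w) \<rho> t) / (circlepath (z + w) \<rho> t - z) *
        (2 * pi * \<i> * \<rho> * exp (2 * of_real pi * \<i> * t))) has_integral 2 * of_real pi * \<i> * f z) {0..1}"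
    unfolding has_contour_integral_def
    by (rule has_integral_eq[rotated]) (auto simp: vector_derivative_circlepath01)
  have "norm (2 * of_real pi * \<i> * f z) \<le> integral {0..1} (\<lambda>t. 4 * pi * norm (f (circlepath (z + w) \<rho> t)))"
  proof (rule integral_norm_bound_integral[of _ "{0..1}", OF has_integral_integrable[OF hi], folded integral_unique[OF hi], unfolded integral_unique[OF hi]])
    show "(\<lambda>t. 4 * pi * norm (f (circlepath (z + w) \<rho> t))) integrable_on {0..1}"
      by (intro integrable_continuous_real continuous_intros c2)
    fix t :: real
    have "\<rho> = norm ((circlepath (z + w) \<rho> t - z) - w)" using circ[of t] by (simp add: algebra_simps)
    also have "\<dots> \<le> norm (circlepath (z + w) \<rho> t - z) + norm w" by (rule norm_triangle_ineq4)
    finally have "norm (circlepath (z + w) \<rho> t - z) \<ge> \<rho> / 2" using w by linarith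
    then have "norm (f (circlepath (z + w) \<rho> t)) / norm (circlepath (z + w) \<rho> t - z) * (2 * pi * \<rho>)
       \<le> norm (f (circlepath (z + w) \<rho> t)) / (\<rho> / 2) * (2 * pi * \<rho>)"
      using \<rho> by (intro mult_right_mono divide_left_mono) (auto intro!: mult_pos_pos)
    then show "norm (f (circlepath (z + w) \<rho> t) / (circlepath (z + w) \<rho> t - z) *
        (2 * pi * \<i> * \<rho> * exp (2 * of_real pi * \<i> * t))) \<le> 4 * pi * norm (f (circlepath (z + w) \<rho> t))"
      using \<rho> by (simp add: norm_mult norm_divide norm_exp_eq_Re field_simps)
  qed
  then show "norm (f z) \<le> 2 * integral {0..1} (\<lambda>t. norm (f (circlepath (z + w) \<rho> t)))"
    by (simp add: norm_mult)
qed

subsection \<open>Sub-mean value properties\<close>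

lemma nn_integral_lborel_translate:
  fixes F :: "'a::euclidean_space \<Rightarrow> ennreal"
  assumes [measurable]: "F \<in> borel_measurable borel"
  shows "(\<integral>\<^sup>+w. F (a + w) \<partial>lborel) = (\<integral>\<^sup>+w. F w \<partial>lborel)"
proof -
  have "(\<integral>\<^sup>+w. F w \<partial>lborel) = (\<integral>\<^sup>+w. F w \<partial>distr lborel borel ((+) a))"
    by (simp add: lborel_distr_plus)
  also have "\<dots> = (\<integral>\<^sup>+w. F (a + w) \<partial>lborel)"
    by (subst nn_integral_distr) auto
  finally show ?thesis ..
qed

lemma borel_measurable_continuous_on_open_ennreal:
  fixes h :: "complex \<Rightarrow> real"
  assumes "continuous_on S h" "open S"
  shows "(\<lambda>x. ennreal (h x) * indicator S x) \<in> borel_measurable borel"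
proof -
  have "(\<lambda>x. ennreal (indicator S x *\<^sub>R h x)) \<in> borel_measurable borel"
    using assms by (intro measurable_compose[OF borel_measurable_continuous_on_indicator] measurable_ennreal) auto
  also have "(\<lambda>x. ennreal (indicator S x *\<^sub>R h x)) = (\<lambda>x. ennreal (h x) * indicator S x)"
    by (auto simp: indicator_def)
  finally show ?thesis .
qed

text \<open>The Cauchy formula is applied on circles whose centre is shifted by \<open>w\<close>; averaging over
  \<open>w\<close> needs only the translation invariance of area, not polar coordinates.\<close>

lemma submean_norm_powr:
  fixes f :: "complex \<Rightarrow> complex"
  assumes f: "f holomorphic_on ball z r" and r: "0 < r" and p: "1 < p"
  shows "ennreal (norm (f z) powr p * r\<^sup>2)
           \<le> ennreal (16 * 2 powr p) * (\<integral>\<^sup>+x\<in>ball z r. ennreal (norm (f x) powr p) \<partial>lborel)"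
proof -
  \<comment> \<open>A shifted circle reaches at most \<open>\<rho> + \<rho> / 2 < r\<close> from
    \<open>z\<close>, so all of them lie in the disc.\<close>
  define \<rho> where "\<rho> = r / 2"
  have \<rho>: "0 < \<rho>" "r = 2 * \<rho>" using r by (auto simp: \<rho>_def)
  define F where "F = (\<lambda>x. ennreal (norm (f x) powr p) * indicator (ball z r) x)"
  define c where "c = (\<lambda>t::real. of_real \<rho> * exp (2 * of_real pi * \<i> * of_real t))"
  have c: "circlepath (z + w) \<rho> t = (z + c t) + w" "norm (c t) = \<rho>" for w t
    using \<rho> by (auto simp: c_def circlepath norm_mult norm_exp_eq_Re)
  have [measurable]: "c \<in> borel_measurable borel"
    unfolding c_def by (intro borel_measurable_continuous_onI continuous_intros)
  have "continuous_on (ball z r) (\<lambda>x. norm (f x) powr p)"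
    using p by (intro continuous_on_powr' continuous_intros holomorphic_on_imp_continuous_on f) auto
  then have F [measurable]: "F \<in> borel_measurable borel"
    unfolding F_def by (intro borel_measurable_continuous_on_open_ennreal) auto
  have pt: "ennreal (norm (f z) powr p) \<le> ennreal (2 powr p) * (\<integral>\<^sup>+t\<in>{0..1}. F ((z + c t) + w) \<partial>lborel)"
    if w: "w \<in> ball 0 (\<rho> / 2)" for w
  proof -
    have w': "norm w < \<rho> / 2" using w by simp
    define u where "u = (\<lambda>t. norm (f (circlepath (z + w) \<rho> t)))"
    have 1: "norm (f z) \<le> 2 * integral {0..1} u" and cu: "continuous_on {0..1} u"
      using norm_le_integral_circlepath[OF f[unfolded \<rho>(2)] \<rho>(1) w'] by (auto simp: u_def)
    have u0: "u t \<ge> 0" for t by (simp add: u_def)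
    have cup: "continuous_on {0..1} (\<lambda>t. u t powr p)"
      using p u0 by (intro continuous_on_powr' continuous_intros cu) auto
    have "norm (f z) powr p \<le> (2 * integral {0..1} u) powr p"
      using p by (intro powr_mono2 1) auto
    also have "\<dots> = 2 powr p * integral {0..1} u powr p"
      using u0 by (simp add: powr_mult integral_nonneg integrable_continuous_real cu)
    also have "integral {0..1} u powr p \<le> integral {0..1} (\<lambda>t. u t powr p)"
      using weighted_power_mean[OF p _ cu, of "\<lambda>_. 1"] u0 by simp
    finally have "norm (f z) powr p \<le> 2 powr p * integral {0..1} (\<lambda>t. u t powr p)" by simp
    then have "ennreal (norm (f z) powr p) \<le> ennreal (2 powr p) * ennreal (integral {0..1} (\<lambda>t. u t powr p))"
      by (metis ennreal_leI ennreal_mult' powr_ge_zero)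
    also have "ennreal (integral {0..1} (\<lambda>t. u t powr p)) = (\<integral>\<^sup>+t\<in>{0..1}. ennreal (u t powr p) \<partial>lborel)"
      by (rule nn_integral_continuous_on_Icc[symmetric, OF cup]) simp
    also have "\<dots> = (\<integral>\<^sup>+t\<in>{0..1}. F ((z + c t) + w) \<partial>lborel)"
    proof (intro nn_integral_cong)
      fix t :: real
      have "norm (c t + w) < 2 * \<rho>"
        using norm_triangle_ineq[of "c t" w] c(2)[of t] w' \<rho> by linarith
      then have "(z + c t) + w \<in> ball z r"
        using \<rho> dist_add_cancel[of z 0 "c t + w"] by (simp add: add.assoc)
      then show "ennreal (u t powr p) * indicator {0..1} t = F ((z + c t) + w) * indicator {0..1} t"
        by (simp add: F_def u_def c)
    qed
    finally show ?thesis .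
  qed
  have "ennreal (norm (f z) powr p) * emeasure lborel (ball (0::complex) (\<rho> / 2))
      = (\<integral>\<^sup>+w\<in>ball (0::complex) (\<rho> / 2). ennreal (norm (f z) powr p) \<partial>lborel)"
    by (subst nn_integral_cmult_indicator) auto
  also have "\<dots> \<le> (\<integral>\<^sup>+w. ennreal (2 powr p) * (\<integral>\<^sup>+t\<in>{0..1}. F ((z + c t) + w) \<partial>lborel) \<partial>lborel)"
    by (intro nn_integral_mono) (use pt in \<open>auto split: split_indicator\<close>)
  also have "\<dots> = ennreal (2 powr p) * (\<integral>\<^sup>+w. (\<integral>\<^sup>+t. F ((z + c t) + w) * indicator {0..1} t \<partial>lborel) \<partial>lborel)"
    by (intro nn_integral_cmult) measurable
  \<comment> \<open>After the exchange, the inner integral over \<open>w\<close> is a translate of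
    the integral of \<open>F\<close> and no longer depends on \<open>t\<close>. Extending
    \<open>w\<close> to the whole plane was harmless because \<open>F\<close> is
    nonnegative.\<close>
  also have "(\<integral>\<^sup>+w. (\<integral>\<^sup>+t. F ((z + c t) + w) * indicator {0..1} t \<partial>lborel) \<partial>lborel)
     = (\<integral>\<^sup>+t. (\<integral>\<^sup>+w. F ((z + c t) + w) * indicator {0..1} t \<partial>lborel) \<partial>lborel)"
    by (intro lborel_pair.Fubini') measurable
  also have "\<dots> = (\<integral>\<^sup>+t. (\<integral>\<^sup>+x. F x \<partial>lborel) * indicator {0..1::real} t \<partial>lborel)"
    by (intro nn_integral_cong, subst nn_integral_multc)
      (measurable, simp add: nn_integral_lborel_translate)
  also have "\<dots> = (\<integral>\<^sup>+x. F x \<partial>lborel)"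
    by (subst nn_integral_cmult_indicator) auto
  finally have main: "ennreal (norm (f z) powr p) * ennreal (pi * (\<rho> / 2)\<^sup>2) \<le> ennreal (2 powr p) * (\<integral>\<^sup>+x. F x \<partial>lborel)"
    using \<rho> by (simp add: emeasure_ball_complex)
  \<comment> \<open>The constant 16 is the ratio of the squares of \<open>r\<close> and
    \<open>\<rho> / 2 = r / 4\<close>; the factor \<open>pi >= 1\<close> is dropped.\<close>
  have "1 * r\<^sup>2 \<le> pi * r\<^sup>2"
    using pi_gt3 by (intro mult_right_mono) auto
  then have "norm (f z) powr p * r\<^sup>2 \<le> 16 * (norm (f z) powr p * (pi * (\<rho> / 2)\<^sup>2))"
    by (simp add: \<rho>_def power_divide mult_left_mono)
  then have "ennreal (norm (f z) powr p * r\<^sup>2) \<le> ennreal 16 * (ennreal (norm (f z) powr p) * ennreal (pi * (\<rho> / 2)\<^sup>2))"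
    by (simp add: ennreal_mult[symmetric] del: ennreal_numeral)
  also have "\<dots> \<le> ennreal 16 * (ennreal (2 powr p) * (\<integral>\<^sup>+x. F x \<partial>lborel))"
    by (intro mult_left_mono main) auto
  also have "\<dots> = ennreal (16 * 2 powr p) * (\<integral>\<^sup>+x. F x \<partial>lborel)"
    by (simp add: ennreal_mult mult.assoc)
  finally show ?thesis by (simp add: F_def)
qed

text \<open>Discs of radius \<open>r / 2\<close> about the points of the circle of radius
  \<open>r / 2\<close> around \<open>z\<close> stay inside \<open>ball z r\<close>. The sub-mean
  value property there bounds \<open>f\<close> on this circle by a number \<open>B\<close>, and
  Cauchy's inequality passes to the derivative. In the exponent \<open>p + 2\<close>, the
  \<open>p\<close> comes from Cauchy's inequality and the 2 from area.\<close>

lemma norm_deriv_powr_le_nn_integral: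
  fixes f :: "complex \<Rightarrow> complex"
  assumes f: "f holomorphic_on ball z r" and r: "0 < r" and p: "1 < p"
  shows "ennreal (norm (deriv f z) powr p * r powr (p + 2))
           \<le> ennreal (64 * 4 powr p) * (\<integral>\<^sup>+x\<in>ball z r. ennreal (norm (f x) powr p) \<partial>lborel)"
proof -
  define T where "T = (\<integral>\<^sup>+x\<in>ball z r. ennreal (norm (f x) powr p) \<partial>lborel)"
  show ?thesis
  \<comment> \<open>The bound \<open>B\<close> is a real number built from the value of
    \<open>T\<close>; for infinite \<open>T\<close> the claim is trivial.\<close>
  proof (cases "T = \<infinity>")
    case True
    then show ?thesis by (simp add: T_def ennreal_mult_top)
  next
    case False
    then obtain \<tau> where \<tau>: "T = ennreal \<tau>" "\<tau> \<ge> 0"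
      by (metis ennreal_cases infinity_ennreal_def)
    define B where "B = (64 * 2 powr p * \<tau> / r\<^sup>2) powr (1 / p)"
    have B: "norm (f u) \<le> B" if u: "norm (z - u) = r / 2" for u
    proof -
      have sub: "ball u (r / 2) \<subseteq> ball z r"
        using u r by (simp add: ball_subset_ball_iff dist_norm norm_minus_commute)
      have "ennreal (norm (f u) powr p * (r / 2)\<^sup>2)
          \<le> ennreal (16 * 2 powr p) * (\<integral>\<^sup>+x\<in>ball u (r / 2). ennreal (norm (f x) powr p) \<partial>lborel)"
        using r p f sub by (intro submean_norm_powr) (auto intro: holomorphic_on_subset)
      also have "\<dots> \<le> ennreal (16 * 2 powr p) * T"
        unfolding T_def using sub by (intro mult_left_mono nn_integral_mono) (auto split: split_indicator)
      also have "\<dots> = ennreal (16 * 2 powr p * \<tau>)"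
        using \<tau> by (simp add: ennreal_mult)
      finally have "norm (f u) powr p * (r / 2)\<^sup>2 \<le> 16 * 2 powr p * \<tau>"
        using \<tau> by (simp add: ennreal_le_iff)
      then have le: "norm (f u) powr p \<le> 64 * 2 powr p * \<tau> / r\<^sup>2"
        using r by (simp add: field_simps power2_eq_square)
      have "norm (f u) = (norm (f u) powr p) powr (1 / p)"
        using p by (simp add: powr_powr)
      also have "\<dots> \<le> B"
        unfolding B_def using p by (intro powr_mono2 le) auto
      finally show ?thesis .
    qed
    have "norm ((deriv ^^ 1) f z) \<le> fact 1 * B / (r / 2) ^ 1"
    proof (rule Cauchy_inequality)
      have sub: "cball z (r / 2) \<subseteq> ball z r" using r by auto
      show "continuous_on (cball z (r / 2)) f"
        using f sub holomorphic_on_imp_continuous_on holomorphic_on_subset by blast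
      show "f holomorphic_on ball z (r / 2)"
        using r by (intro holomorphic_on_subset[OF f]) auto
    qed (use r B in auto)
    then have "norm (deriv f z) \<le> 2 / r * B" by (simp add: mult.commute)
    then have "norm (deriv f z) powr p \<le> (2 / r * B) powr p"
      using p by (intro powr_mono2) auto
    also have "\<dots> = (2 / r) powr p * B powr p"
      by (rule powr_mult)
    also have "B powr p = 64 * 2 powr p * \<tau> / r\<^sup>2"
      using p \<tau> by (simp add: B_def powr_powr)
    finally have "norm (deriv f z) powr p * r powr (p + 2)
        \<le> (2 / r) powr p * (64 * 2 powr p * \<tau> / r\<^sup>2) * r powr (p + 2)"
      by (intro mult_right_mono) auto
    also have "\<dots> = 64 * (2 powr p * 2 powr p) * \<tau>"
      using r by (simp add: powr_divide powr_add)
    also have "\<dots> = 64 * 4 powr p * \<tau>"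
      by (simp flip: powr_mult)
    finally have "ennreal (norm (deriv f z) powr p * r powr (p + 2)) \<le> ennreal (64 * 4 powr p * \<tau>)"
      by (rule ennreal_leI)
    also have "\<dots> = ennreal (64 * 4 powr p) * T"
      using \<tau> by (simp add: ennreal_mult)
    finally show ?thesis by (simp add: T_def)
  qed
qed

subsection \<open>Assouad dimension and integrals of distance functions\<close>

text \<open>A finite bound excludes an empty family of covers, whose infimum is infinite; a nonempty
  set of extended naturals attains its infimum, so an actual cover of that size exists.\<close>

lemma covering_number_leD:
  assumes "ereal_of_enat (covering_number r A) \<le> ereal X"
  obtains F where "finite F" "A \<subseteq> (\<Union>c\<in>F. ball c r)" "real (card F) \<le> X"
proof -
  define S where "S = (\<lambda>F::complex set. enat (card F)) ` {F. finite F \<and> A \<subseteq> (\<Union>c\<in>F. ball c r)}"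
  have le: "ereal_of_enat (Inf S) \<le> ereal X"
    using assms by (simp add: covering_number_def S_def)
  then have "S \<noteq> {}" by (auto simp: Inf_enat_def)
  then have "Inf S \<in> S"
    unfolding Inf_enat_def by (auto intro: LeastI)
  then obtain F where F: "finite F" "A \<subseteq> (\<Union>c\<in>F. ball c r)" "Inf S = enat (card F)"
    by (auto simp: S_def)
  then show ?thesis using le that by auto
qed

lemma assouad_dim_lessE:
  assumes "assouad_dim E < ereal t"
  obtains s C where "0 \<le> s" "s < t" "0 < C"
    "\<forall>x\<in>E. \<forall>r R. 0 < r \<and> r < R \<longrightarrow>
       (\<exists>F. finite F \<and> E \<inter> ball x R \<subseteq> (\<Union>c\<in>F. ball c r) \<and> real (card F) \<le> C * (R / r) powr s)"
proof -
  obtain s C where sC: "0 \<le> s" "s < t" "0 < C" and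
    le: "\<And>x r R. x \<in> E \<Longrightarrow> 0 < r \<Longrightarrow> r < R \<Longrightarrow>
          ereal_of_enat (covering_number r (E \<inter> ball x R)) \<le> ereal (C * (R / r) powr s)"
    using assms unfolding assouad_dim_def INF_less_iff by auto
  show ?thesis
  proof (rule that[OF sC], intro ballI allI impI)
    fix x and r R :: real assume "x \<in> E" "0 < r \<and> r < R"
    then have "ereal_of_enat (covering_number r (E \<inter> ball x R)) \<le> ereal (C * (R / r) powr s)"
      by (intro le) auto
    then obtain F where "finite F" "E \<inter> ball x R \<subseteq> (\<Union>c\<in>F. ball c r)"
        "real (card F) \<le> C * (R / r) powr s"
      by (rule covering_number_leD)
    then show "\<exists>F. finite F \<and> E \<inter> ball x R \<subseteq> (\<Union>c\<in>F. ball c r) \<and> real (card F) \<le> C * (R / r) powr s"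
      by blast
  qed
qed

lemma dyadic_scale:
  fixes d R :: real
  assumes "0 < d" "d \<le> R"
  obtains j :: nat where "R * 2 powr (- real j) / 2 < d" "d \<le> R * 2 powr (- real j)"
proof -
  have R: "R > 0" using assms by auto
  define y where "y = log 2 (R / d)"
  have y: "y \<ge> 0" "R / d = 2 powr y" using assms R by (auto simp: y_def)
  define j where "j = nat \<lfloor>y\<rfloor>"
  have j: "real j \<le> y" "y < real j + 1" using y by (auto simp: j_def)
  have d: "d = R * 2 powr (- y)"
    using y assms R by (simp add: powr_minus field_simps)
  have "2 powr (- y) \<le> 2 powr (- real j)" using j by simp
  moreover have "2 powr (- real j) < 2 powr (1 - y)" using j by simp
  then have "2 powr (- real j) / 2 < 2 powr (- y)" by (simp add: powr_diff powr_minus field_simps)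
  ultimately show ?thesis using R d that[of j] by auto
qed

text \<open>At scale \<open>r j = R * 2 powr (- real j)\<close> the points within \<open>r j\<close>
  of \<open>E\<close> are covered by about \<open>2 powr (j * s)\<close> discs of radius
  \<open>2 * r j\<close>. Their area times \<open>r j powr \<beta>\<close> is a constant times
  \<open>R powr (\<beta> + 2) * q ^ j\<close>, and \<open>s < \<beta> + 2\<close> says exactly that
  this geometric series converges. Full sublevel sets replace annuli, since overcounting does not
  harm an upper bound.\<close>

lemma nn_integral_infdist_powr_le:
  fixes E :: "complex set" and s C \<beta> :: real
  assumes E: "closed E" "E \<noteq> {}" and s: "0 \<le> s" "s < \<beta> + 2" and C: "0 < C"
    and cover: "\<forall>x\<in>E. \<forall>r R. 0 < r \<and> r < R \<longrightarrow>
       (\<exists>F. finite F \<and> E \<inter> ball x R \<subseteq> (\<Union>c\<in>F. ball c r) \<and> real (card F) \<le> C * (R / r) powr s)"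
  obtains K where "0 < K" "\<forall>\<xi>\<in>E. \<forall>R>0.
    (\<integral>\<^sup>+x\<in>cball \<xi> R. ennreal (infdist x E powr \<beta>) \<partial>lborel) \<le> ennreal (K * R powr (\<beta> + 2))"
proof -
  define q where "q = 2 powr (s - \<beta> - 2)"
  have q: "0 < q" "q < 1" using s by (auto simp: q_def powr_less_one)
  define A where "A = 2 powr \<bar>\<beta>\<bar> * (C * 3 powr s) * 4 * pi"
  have A: "A > 0" using C by (simp add: A_def)
  show ?thesis
  proof (rule that[of "A / (1 - q)"]; (intro ballI allI impI)?)
    show "0 < A / (1 - q)" using A q by simp
    fix \<xi> R assume \<xi>: "\<xi> \<in> E" and R: "(0::real) < R"
    define r where "r = (\<lambda>j::nat. R * 2 powr (- real j))"
    have r: "0 < r j" "r j \<le> R" for j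
    proof -
      have "2 powr (- real j) \<le> 2 powr 0" by (intro powr_mono) auto
      then show "0 < r j" "r j \<le> R" using R by (auto simp: r_def mult_le_cancel_left2)
    qed
    define L where "L = (\<lambda>j. {x \<in> cball \<xi> R. infdist x E \<le> r j})"
    have [measurable]: "L j \<in> sets borel" for j
    proof -
      have "closed (cball \<xi> R \<inter> {x. infdist x E \<le> r j})"
        by (intro closed_Int closed_cball closed_Collect_le continuous_intros)
      moreover have "L j = cball \<xi> R \<inter> {x. infdist x E \<le> r j}"
        by (auto simp: L_def)
      ultimately show ?thesis by simp
    qed
    have vol: "emeasure lborel (L j) \<le> ennreal (C * (3 * R / r j) powr s * (4 * pi * (r j)\<^sup>2))" for j
    proof -
      obtain F where F: "finite F" "E \<inter> ball \<xi> (3 * R) \<subseteq> (\<Union>c\<in>F. ball c (r j))"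
          "real (card F) \<le> C * (3 * R / r j) powr s"
        \<comment> \<open>Nearest points of \<open>E\<close> lie within \<open>2 * R\<close> of
          \<open>\<xi>\<close>. The radius \<open>3 * R\<close> puts them in the open ball and makes
          \<open>r j < 3 * R\<close> strict, also for \<open>j = 0\<close>.\<close>
        using cover[rule_format, OF \<xi>, of "r j" "3 * R"] r[of j] R by auto
      have "L j \<subseteq> (\<Union>c\<in>F. ball c (2 * r j))"
      proof
        fix x assume x: "x \<in> L j"
        obtain \<eta> where \<eta>: "\<eta> \<in> E" "infdist x E = dist x \<eta>"
          using infdist_attains_inf[OF E] by metis
        have d: "dist x \<eta> \<le> r j" "dist \<xi> x \<le> R" using x \<eta> by (auto simp: L_def)
        then have "dist \<xi> \<eta> < 3 * R"
          using dist_triangle[of \<xi> \<eta> x] r[of j] R by linarith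
        then obtain c where c: "c \<in> F" "dist c \<eta> < r j" using F(2) \<eta>(1) by auto
        then have "dist c x < 2 * r j"
          using dist_triangle2[of c x \<eta>] d by linarith
        then show "x \<in> (\<Union>c\<in>F. ball c (2 * r j))" using c by auto
      qed
      then have "emeasure lborel (L j) \<le> emeasure lborel (\<Union>c\<in>F. ball c (2 * r j))"
        by (intro emeasure_mono) (auto intro!: borel_open)
      also have "\<dots> \<le> (\<Sum>c\<in>F. emeasure lborel (ball c (2 * r j)))"
        using F by (intro emeasure_subadditive_finite) auto
      also have "\<dots> = (\<Sum>c\<in>F. ennreal (4 * pi * (r j)\<^sup>2))"
        using r[of j] by (intro sum.cong) (auto simp: emeasure_ball_complex power2_eq_square mult_ac)
      also have "\<dots> = ennreal (real (card F) * (4 * pi * (r j)\<^sup>2))"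
        by (simp add: ennreal_mult ennreal_of_nat_eq_real_of_nat)
      also have "\<dots> \<le> ennreal (C * (3 * R / r j) powr s * (4 * pi * (r j)\<^sup>2))"
        using F(3) by (intro ennreal_leI mult_right_mono) auto
      finally show ?thesis .
    qed
    have pt: "ennreal (infdist x E powr \<beta>) * indicator (cball \<xi> R) x
        \<le> (\<Sum>j. ennreal (2 powr \<bar>\<beta>\<bar> * r j powr \<beta>) * indicator (L j) x)" for x
    proof (cases "x \<in> cball \<xi> R \<and> infdist x E > 0")
      case True
      then have "infdist x E \<le> R" using infdist_le[OF \<xi>, of x] by (auto simp: dist_commute)
      then obtain j where j: "r j / 2 < infdist x E" "infdist x E \<le> r j"
        using dyadic_scale[of "infdist x E" R] True unfolding r_def by metis
      have "infdist x E powr \<beta> \<le> 2 powr \<bar>\<beta>\<bar> * r j powr \<beta>"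
        using True j r[of j] by (intro powr_comparable) auto
      \<comment> \<open>A single layer already dominates the integrand: on the scale
        \<open>j\<close> just found, \<open>infdist x E\<close> and \<open>r j\<close> agree up to a
        factor 2.\<close>
      then have "ennreal (infdist x E powr \<beta>) * indicator (cball \<xi> R) x
         \<le> (\<Sum>i\<in>{j}. ennreal (2 powr \<bar>\<beta>\<bar> * r i powr \<beta>) * indicator (L i) x)"
        using True j by (simp add: L_def ennreal_leI)
      also have "\<dots> \<le> (\<Sum>j. ennreal (2 powr \<bar>\<beta>\<bar> * r j powr \<beta>) * indicator (L j) x)"
        by (intro sum_le_suminf) auto
      finally show ?thesis .
    next
      case False
      \<comment> \<open>On \<open>E\<close> itself the integrand is 0 by the convention
        \<open>0 powr \<beta> = 0\<close>, which holds for negative \<open>\<beta>\<close> as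
        well.\<close>
      then have "x \<notin> cball \<xi> R \<or> infdist x E = 0"
        using infdist_nonneg[of x E] by linarith
      then show ?thesis by auto
    qed
    have "(\<integral>\<^sup>+x\<in>cball \<xi> R. ennreal (infdist x E powr \<beta>) \<partial>lborel)
       \<le> (\<integral>\<^sup>+x. (\<Sum>j. ennreal (2 powr \<bar>\<beta>\<bar> * r j powr \<beta>) * indicator (L j) x) \<partial>lborel)"
      by (intro nn_integral_mono pt)
    also have "\<dots> = (\<Sum>j. \<integral>\<^sup>+x. ennreal (2 powr \<bar>\<beta>\<bar> * r j powr \<beta>) * indicator (L j) x \<partial>lborel)"
      by (intro nn_integral_suminf) measurable
    also have "\<dots> = (\<Sum>j. ennreal (2 powr \<bar>\<beta>\<bar> * r j powr \<beta>) * emeasure lborel (L j))"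
      by (intro suminf_cong nn_integral_cmult_indicator) auto
    also have "\<dots> \<le> (\<Sum>j. ennreal (A * R powr (\<beta> + 2) * q ^ j))"
    proof (intro suminf_le)
      fix j
      have "ennreal (2 powr \<bar>\<beta>\<bar> * r j powr \<beta>) * emeasure lborel (L j)
        \<le> ennreal (2 powr \<bar>\<beta>\<bar> * r j powr \<beta>) * ennreal (C * (3 * R / r j) powr s * (4 * pi * (r j)\<^sup>2))"
        by (intro mult_left_mono vol) auto
      also have "\<dots> = ennreal (2 powr \<bar>\<beta>\<bar> * r j powr \<beta> * (C * (3 * R / r j) powr s * (4 * pi * (r j)\<^sup>2)))"
        using C by (intro ennreal_mult[symmetric]) auto
      also have "2 powr \<bar>\<beta>\<bar> * r j powr \<beta> * (C * (3 * R / r j) powr s * (4 * pi * (r j)\<^sup>2))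
         = A * R powr (\<beta> + 2) * q ^ j"
      proof -
        have "3 * R / r j = 3 * 2 powr real j"
          using R by (simp add: r_def powr_minus field_simps)
        then have 1: "(3 * R / r j) powr s = 3 powr s * 2 powr (real j * s)"
          by (simp add: powr_mult powr_powr)
        have 2: "(r j)\<^sup>2 = r j powr 2" using r[of j] by simp
        have 3: "r j powr \<beta> * r j powr 2 = R powr (\<beta> + 2) * 2 powr (- real j * (\<beta> + 2))"
        proof -
          have "r j powr \<beta> * r j powr 2 = r j powr (\<beta> + 2)"
            by (rule powr_add[symmetric])
          then show ?thesis by (simp add: r_def powr_mult powr_powr)
        qed
        have "q ^ j = 2 powr ((s - \<beta> - 2) * real j)"
          unfolding q_def by (simp add: powr_powr flip: powr_realpow)
        also have "(s - \<beta> - 2) * real j = real j * s + - real j * (\<beta> + 2)"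
          by (simp add: algebra_simps)
        finally have 4: "q ^ j = 2 powr (real j * s) * 2 powr (- real j * (\<beta> + 2))"
          by (simp only: powr_add)
        have "2 powr \<bar>\<beta>\<bar> * r j powr \<beta> * (C * (3 * R / r j) powr s * (4 * pi * (r j)\<^sup>2))
          = 2 powr \<bar>\<beta>\<bar> * C * (3 powr s * 2 powr (real j * s)) * 4 * pi * (r j powr \<beta> * r j powr 2)"
          unfolding 1 2 by (simp only: mult_ac)
        then show ?thesis unfolding 3 4 A_def by (simp only: mult_ac)
      qed
      finally show "ennreal (2 powr \<bar>\<beta>\<bar> * r j powr \<beta>) * emeasure lborel (L j)
        \<le> ennreal (A * R powr (\<beta> + 2) * q ^ j)" .
    qed auto
    also have "\<dots> = ennreal (A * R powr (\<beta> + 2) * (1 / (1 - q)))"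
      using A q by (intro suminf_ennreal_eq sums_mult geometric_sums) auto
    finally show "(\<integral>\<^sup>+x\<in>cball \<xi> R. ennreal (infdist x E powr \<beta>) \<partial>lborel)
      \<le> ennreal (A / (1 - q) * R powr (\<beta> + 2))"
      by (simp add: mult_ac)
  qed
qed

subsection \<open>Integration along rectifiable curves\<close>

text \<open>The curve is only known to be 1-Lipschitz, so \<open>g \<circ> \<gamma>\<close> need not
  be differentiable at every time. Instead, differentiability of \<open>g\<close> at the tags of a
  sufficiently fine tagged division bounds the increment over each piece by (\<open>h\<close> at the
  tag plus \<open>e\<close>) times its length; the increments telescope and the bounds form a
  Riemann sum.\<close>

lemma norm_diff_le_integral_deriv_path:
  fixes g :: "complex \<Rightarrow> complex" and \<gamma> :: "real \<Rightarrow> complex"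
  assumes g: "g holomorphic_on S" and S: "open S" and l: "0 \<le> l"
    and \<gamma>S: "\<gamma> ` {0..l} \<subseteq> S"
    and lip: "\<And>s t. 0 \<le> s \<Longrightarrow> s \<le> t \<Longrightarrow> t \<le> l \<Longrightarrow> dist (\<gamma> s) (\<gamma> t) \<le> t - s"
    and c\<gamma>: "continuous_on {0..l} \<gamma>"
  shows "norm (g (\<gamma> l) - g (\<gamma> 0)) \<le> integral {0..l} (\<lambda>t. norm (deriv g (\<gamma> t)))"
    and "continuous_on {0..l} (\<lambda>t. norm (deriv g (\<gamma> t)))"
proof -
  define h where "h = (\<lambda>t. norm (deriv g (\<gamma> t)))"
  have "continuous_on S (deriv g)"
    using g S holomorphic_deriv holomorphic_on_imp_continuous_on by blast
  then have "continuous_on {0..l} (deriv g \<circ> \<gamma>)"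
    using c\<gamma> \<gamma>S by (intro continuous_on_compose) (auto intro: continuous_on_subset)
  then show ch: "continuous_on {0..l} (\<lambda>t. norm (deriv g (\<gamma> t)))"
    by (intro continuous_intros) (simp add: o_def)
  define H where "H = integral {0..l} h"
  have hH: "(h has_integral H) {0..l}"
    unfolding H_def using ch by (intro integrable_integral integrable_continuous_real) (simp add: h_def)
  show "norm (g (\<gamma> l) - g (\<gamma> 0)) \<le> integral {0..l} (\<lambda>t. norm (deriv g (\<gamma> t)))"
  proof (rule field_le_epsilon)
    fix \<epsilon> :: real assume \<epsilon>: "\<epsilon> > 0"
    \<comment> \<open>The pieces lose \<open>e * l\<close> in total and the Riemann sum another
      \<open>e\<close>.\<close>
    define e where "e = \<epsilon> / (l + 1)"
    have "e * (l + 1) = \<epsilon>" using l by (simp add: e_def)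
    then have e: "e > 0" "e * l + e = \<epsilon>" using \<epsilon> l by (auto simp: e_def distrib_left)
    have "\<exists>\<eta>>0. \<forall>y. norm (y - \<gamma> t) < \<eta> \<longrightarrow> norm (g y - g (\<gamma> t)) \<le> (h t + e) * norm (y - \<gamma> t)"
      if t: "t \<in> {0..l}" for t
    proof -
      have "\<gamma> t \<in> S" using t \<gamma>S by auto
      then have "(g has_field_derivative deriv g (\<gamma> t)) (at (\<gamma> t))"
        using g S holomorphic_derivI by blast
      then have "(g has_derivative (*) (deriv g (\<gamma> t))) (at (\<gamma> t))"
        by (simp add: has_field_derivative_def)
      then obtain \<eta> where \<eta>: "\<eta> > 0" "\<And>y. norm (y - \<gamma> t) < \<eta> \<Longrightarrow>
          norm (g y - g (\<gamma> t) - deriv g (\<gamma> t) * (y - \<gamma> t)) \<le> e * norm (y - \<gamma> t)"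
        using e(1) unfolding has_derivative_at_alt by meson
      have "norm (g y - g (\<gamma> t)) \<le> (h t + e) * norm (y - \<gamma> t)" if "norm (y - \<gamma> t) < \<eta>" for y
      proof -
        have "norm (deriv g (\<gamma> t) * (y - \<gamma> t)) = h t * norm (y - \<gamma> t)"
          by (simp add: h_def norm_mult)
        then show ?thesis
          using \<eta>(2)[OF that] norm_triangle_sub[of "g y - g (\<gamma> t)" "deriv g (\<gamma> t) * (y - \<gamma> t)"]
          by (simp only: distrib_right)
      qed
      then show ?thesis using \<eta>(1) by blast
    qed
    then obtain \<eta> where \<eta>: "\<And>t. t \<in> {0..l} \<Longrightarrow> \<eta> t > 0"
      "\<And>t y. t \<in> {0..l} \<Longrightarrow> norm (y - \<gamma> t) < \<eta> t \<Longrightarrow> norm (g y - g (\<gamma> t)) \<le> (h t + e) * norm (y - \<gamma> t)"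
      by metis
    obtain d where d: "gauge d" "\<And>\<D>. \<D> tagged_division_of {0..l} \<Longrightarrow> d fine \<D> \<Longrightarrow>
        norm ((\<Sum>(x,k)\<in>\<D>. measure lborel k *\<^sub>R h x) - H) < e"
      using hH[unfolded has_integral_real] e(1) by meson
    \<comment> \<open>Fineness serves both the Riemann sum and the local estimate at the tag. Tags
      always lie in \<open>{0..l}\<close>; the default radius 1 only makes \<open>d'\<close> a gauge
      on the whole line.\<close>
    define d' where "d' = (\<lambda>t. d t \<inter> ball t (if t \<in> {0..l} then \<eta> t else 1))"
    have "gauge d'"
      unfolding d'_def using d(1) \<eta>(1) by (intro gauge_Int gauge_ball_dependent) auto
    then obtain \<D> where \<D>: "\<D> tagged_division_of {0..l}" "d' fine \<D>"
      using fine_division_exists_real by metis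
    have "d fine \<D>" using \<D>(2) by (auto simp: d'_def fine_def)
    then have close: "norm ((\<Sum>(x,k)\<in>\<D>. measure lborel k *\<^sub>R h x) - H) < e"
      using d(2)[OF \<D>(1)] by simp
    have piece: "norm (g (\<gamma> (Sup k)) - g (\<gamma> (Inf k))) \<le> (h x + e) * measure lborel k" if xk: "(x, k) \<in> \<D>" for x k
    proof -
      obtain u v where k: "k = {u..v}" using tagged_division_ofD(4)[OF \<D>(1) xk] by auto
      have xk': "x \<in> {u..v}" "{u..v} \<subseteq> {0..l}" using tagged_division_ofD(2,3)[OF \<D>(1) xk] k by auto
      then have uv: "u \<le> x" "x \<le> v" "0 \<le> u" "v \<le> l" by auto
      have x0: "x \<in> {0..l}" using uv by auto
      have "k \<subseteq> d' x" using \<D>(2) xk by (auto simp: fine_def)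
      then have "{u..v} \<subseteq> ball x (\<eta> x)" using x0 k by (auto simp: d'_def)
      moreover have "u \<in> {u..v}" "v \<in> {u..v}" using uv by auto
      ultimately have "v \<in> ball x (\<eta> x)" "u \<in> ball x (\<eta> x)" by blast+
      then have \<eta>uv: "v - x < \<eta> x" "x - u < \<eta> x" using uv by (auto simp: dist_real_def)
      have lv: "norm (\<gamma> v - \<gamma> x) \<le> v - x" and lu: "norm (\<gamma> u - \<gamma> x) \<le> x - u"
        using lip[of x v] lip[of u x] uv by (auto simp: dist_norm norm_minus_commute)
      have h0: "h x + e \<ge> 0" using e by (simp add: h_def)
      \<comment> \<open>Both endpoints are compared with the tag \<open>x\<close>; since
        \<open>u \<le> x \<le> v\<close>, the two bounds add up to the full length
        \<open>v - u\<close>.\<close>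
      have "norm (g (\<gamma> v) - g (\<gamma> x)) \<le> (h x + e) * norm (\<gamma> v - \<gamma> x)"
        using lv \<eta>uv by (intro \<eta>(2)[OF x0]) auto
      also have "\<dots> \<le> (h x + e) * (v - x)" by (intro mult_left_mono lv h0)
      finally have 1: "norm (g (\<gamma> v) - g (\<gamma> x)) \<le> (h x + e) * (v - x)" .
      have "norm (g (\<gamma> u) - g (\<gamma> x)) \<le> (h x + e) * norm (\<gamma> u - \<gamma> x)"
        using lu \<eta>uv by (intro \<eta>(2)[OF x0]) auto
      also have "\<dots> \<le> (h x + e) * (x - u)" by (intro mult_left_mono lu h0)
      finally have 2: "norm (g (\<gamma> u) - g (\<gamma> x)) \<le> (h x + e) * (x - u)" .
      have "norm (g (\<gamma> v) - g (\<gamma> u)) \<le> (h x + e) * (v - x) + (h x + e) * (x - u)"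
        using norm_triangle_ineq4[of "g (\<gamma> v) - g (\<gamma> x)" "g (\<gamma> u) - g (\<gamma> x)"] 1 2 by simp
      then show ?thesis using uv k by (simp add: algebra_simps)
    qed
    have "g (\<gamma> l) - g (\<gamma> 0) = (\<Sum>(x,k)\<in>\<D>. g (\<gamma> (Sup k)) - g (\<gamma> (Inf k)))"
      using additive_tagged_division_1[OF l \<D>(1), of "\<lambda>t. g (\<gamma> t)"] by simp
    also have "norm \<dots> \<le> (\<Sum>(x,k)\<in>\<D>. (h x + e) * measure lborel k)"
      by (intro sum_norm_le) (use piece in auto)
    also have "\<dots> = (\<Sum>(x,k)\<in>\<D>. measure lborel k *\<^sub>R h x) + e * (\<Sum>(x,k)\<in>\<D>. measure lborel k)"
      by (simp add: case_prod_unfold algebra_simps sum.distrib sum_distrib_left)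
    also have "(\<Sum>(x,k)\<in>\<D>. measure lborel k) = l"
      using additive_content_tagged_division[of \<D> 0 l] \<D>(1) l by simp
    also have "(\<Sum>(x,k)\<in>\<D>. measure lborel k *\<^sub>R h x) \<le> H + e"
      using close by (simp add: abs_if split: if_splits)
    finally show "norm (g (\<gamma> l) - g (\<gamma> 0)) \<le> integral {0..l} (\<lambda>t. norm (deriv g (\<gamma> t))) + \<epsilon>"
      using e(2) by (simp add: H_def h_def)
  qed
qed

text \<open>Every partition of \<open>{0..s}\<close> extends by the point \<open>t\<close> to one of
  \<open>{0..t}\<close>. Hence the length up to \<open>s\<close> plus the chord from
  \<open>\<gamma> s\<close> to \<open>\<gamma> t\<close> is at most the length up to
  \<open>t\<close>, and these lengths are \<open>s\<close> and \<open>t\<close>.\<close>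

lemma arclength_curve_dist_le:
  assumes arc: "arclength_curve \<gamma> l" and st: "0 \<le> s" "s \<le> t" "t \<le> l"
  shows "dist (\<gamma> s) (\<gamma> t) \<le> t - s"
proof -
  let ?P = "\<lambda>b. {(n::nat, \<tau>::nat \<Rightarrow> real). \<tau> 0 = 0 \<and> \<tau> n = b \<and> mono_on {..n} \<tau>}"
  have len: "curve_length \<gamma> 0 b = ennreal b" if "b \<in> {0..l}" for b
    using arc that by (auto simp: arclength_curve_def)
  have ext: "(\<Sum>i<n. dist (\<gamma> (\<tau> i)) (\<gamma> (\<tau> (Suc i)))) + dist (\<gamma> s) (\<gamma> t) \<le> t"
    if "(n, \<tau>) \<in> ?P s" for n \<tau>
  proof -
    have \<tau>: "\<tau> 0 = 0" "\<tau> n = s" "mono_on {..n} \<tau>" using that by auto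
    define \<sigma> where "\<sigma> = (\<lambda>i. if i \<le> n then \<tau> i else t)"
    have "\<tau> i \<le> t" if "i \<le> n" for i
      using mono_onD[OF \<tau>(3), of i n] that \<tau> st by auto
    then have "mono_on {..Suc n} \<sigma>"
      using \<tau>(3) by (auto simp: \<sigma>_def mono_on_def)
    then have "(Suc n, \<sigma>) \<in> ?P t" using \<tau> by (auto simp: \<sigma>_def)
    then have "ennreal (\<Sum>i<Suc n. dist (\<gamma> (\<sigma> i)) (\<gamma> (\<sigma> (Suc i)))) \<le> curve_length \<gamma> 0 t"
      unfolding curve_length_def by (intro SUP_upper2[of "(Suc n, \<sigma>)"]) auto
    also have "\<dots> = ennreal t" using len st by auto
    also have "(\<Sum>i<Suc n. dist (\<gamma> (\<sigma> i)) (\<gamma> (\<sigma> (Suc i))))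
        = (\<Sum>i<n. dist (\<gamma> (\<tau> i)) (\<gamma> (\<tau> (Suc i)))) + dist (\<gamma> s) (\<gamma> t)"
      using \<tau> by (simp add: \<sigma>_def)
    finally show ?thesis using st by (subst (asm) ennreal_le_iff) auto
  qed
  have "curve_length \<gamma> 0 s \<le> ennreal (t - dist (\<gamma> s) (\<gamma> t))"
    unfolding curve_length_def
    by (intro SUP_least) (use ext in \<open>force intro!: ennreal_leI simp: algebra_simps\<close>)
  then have "ennreal s \<le> ennreal (t - dist (\<gamma> s) (\<gamma> t))" using len st by auto
  \<comment> \<open>\<open>ennreal\<close> truncates negative reals, so
    \<open>t - dist (\<gamma> s) (\<gamma> t)\<close> must be seen to be nonnegative before
    returning to the reals; the one-piece partition of \<open>{0..s}\<close> shows it.\<close>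
  moreover have "(1, \<lambda>i. if i = 0 then 0 else s) \<in> ?P s"
    using st by (auto simp: mono_on_def)
  from ext[OF this] have "dist (\<gamma> 0) (\<gamma> s) + dist (\<gamma> s) (\<gamma> t) \<le> t"
    by simp
  then have "dist (\<gamma> s) (\<gamma> t) \<le> t"
    using zero_le_dist[of "\<gamma> 0" "\<gamma> s"] by linarith
  ultimately show ?thesis using st by (subst (asm) ennreal_le_iff) auto
qed

text \<open>The antiderivative is \<open>- m * (t + d) powr (- 1 / m)\<close>, and dropping its
  value at \<open>l\<close> gives a bound that does not depend on the length of the curve.\<close>

lemma integral_powr_shift_le:
  fixes d l m :: real
  assumes "0 < d" "0 \<le> l" "0 < m"
  shows "integral {0..l} (\<lambda>t. (t + d) powr (- 1 - 1 / m)) \<le> m * d powr (- 1 / m)"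
proof -
  have "((\<lambda>t. (t + d) powr (- 1 - 1 / m)) has_integral
      (- m * (l + d) powr (- 1 / m)) - (- m * (0 + d) powr (- 1 / m))) {0..l}"
  proof (rule fundamental_theorem_of_calculus)
    fix t assume "t \<in> {0..l}"
    then have t: "0 < t + d" using assms by auto
    have "((\<lambda>t. - m * (t + d) powr (- 1 / m)) has_real_derivative
        - m * ((- 1 / m) * (t + d) powr (- 1 / m - 1))) (at t within {0..l})"
      using t by (auto intro!: derivative_eq_intros)
    also have "- m * ((- 1 / m) * (t + d) powr (- 1 / m - 1)) = (t + d) powr (- 1 - 1 / m)"
    proof -
      have "- 1 / m - 1 = - 1 - 1 / m" by simp
      then show ?thesis using assms by (simp only:) simp
    qed
    finally show "((\<lambda>t. - m * (t + d) powr (- 1 / m)) has_vector_derivative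
        (t + d) powr (- 1 - 1 / m)) (at t within {0..l})"
      by (simp add: has_real_derivative_iff_has_vector_derivative)
  qed (use assms in auto)
  then have "integral {0..l} (\<lambda>t. (t + d) powr (- 1 - 1 / m)) =
      (- m * (l + d) powr (- 1 / m)) - (- m * (0 + d) powr (- 1 / m))"
    by (rule integral_unique)
  then show ?thesis using assms by simp
qed

subsection \<open>Weighted integrals on bounded open sets\<close>

locale bounded_open_set =
  fixes \<Omega> :: "complex set"
  assumes open_\<Omega>: "open \<Omega>" and bounded_\<Omega>: "bounded \<Omega>" and nonempty_\<Omega>: "\<Omega> \<noteq> {}"
begin

abbreviation \<delta> :: "complex \<Rightarrow> real" where "\<delta> \<equiv> bdry_dist \<Omega>"

text \<open>\<open>infdist\<close> to the empty set is 0 by convention, so this fact underlies the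
  positivity of \<open>\<delta>\<close> on \<open>\<Omega>\<close>. It holds because a bounded set
  is not the whole plane.\<close>

lemma frontier_nonempty: "frontier \<Omega> \<noteq> {}"
  using nonempty_\<Omega> bounded_\<Omega> not_bounded_UNIV frontier_eq_empty by blast

lemma \<delta>_nonneg: "0 \<le> \<delta> z"
  by (simp add: bdry_dist_def infdist_nonneg)

lemma \<delta>_le: "\<delta> x \<le> \<delta> y + dist x y"
  by (simp add: bdry_dist_def infdist_triangle)

lemma \<delta>_pos: assumes "z \<in> \<Omega>" shows "0 < \<delta> z"
proof -
  have "z \<notin> frontier \<Omega>"
    using assms open_\<Omega> by (simp add: frontier_def interior_open)
  then show ?thesis
    using frontier_nonempty by (simp add: bdry_dist_def infdist_pos_not_in_closed)
qed

lemma continuous_on_\<delta> [continuous_intros]: "continuous_on S \<delta>"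
  by (simp add: bdry_dist_def[abs_def] continuous_on_infdist)

lemma borel_measurable_\<delta> [measurable]: "\<delta> \<in> borel_measurable borel"
  by (intro borel_measurable_continuous_onI continuous_on_\<delta>)

lemma \<Omega>_borel [measurable]: "\<Omega> \<in> sets borel"
  using open_\<Omega> by simp

text \<open>A connected disc that meets both \<open>\<Omega>\<close> and its complement would
  contain a boundary point closer to \<open>z\<close> than \<open>\<delta> z\<close>.\<close>

lemma ball_\<delta>_subset: assumes "z \<in> \<Omega>" "r \<le> \<delta> z" shows "ball z r \<subseteq> \<Omega>"
proof (rule ccontr)
  assume *: "\<not> ball z r \<subseteq> \<Omega>"
  then have "0 < r" by (metis ball_eq_empty empty_subsetI not_less)
  then have "ball z r \<inter> frontier \<Omega> \<noteq> {}"
    using assms * by (intro connected_Int_frontier) (auto intro: centre_in_ball[THEN iffD2])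
  then obtain y where "y \<in> frontier \<Omega>" "dist z y < r" by auto
  then show False
    using infdist_le[of y "frontier \<Omega>" z] assms by (simp add: bdry_dist_def)
qed

lemma nearest_frontier_point: obtains \<xi> where "\<xi> \<in> frontier \<Omega>" "\<delta> z = dist z \<xi>"
  using infdist_attains_inf[OF frontier_closed frontier_nonempty] unfolding bdry_dist_def by metis

lemma borel_measurable_weighted [measurable]:
  fixes f :: "complex \<Rightarrow> complex"
  assumes "continuous_on \<Omega> f" "1 < p"
  shows "(\<lambda>z. ennreal (norm (f z) powr p * \<delta> z powr e) * indicator \<Omega> z) \<in> borel_measurable borel"
proof (intro borel_measurable_continuous_on_open_ennreal open_\<Omega>)
  have "\<forall>z\<in>\<Omega>. \<delta> z \<noteq> 0" using \<delta>_pos by force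
  then show "continuous_on \<Omega> (\<lambda>z. norm (f z) powr p * \<delta> z powr e)"
    using assms \<delta>_nonneg
    by (intro continuous_on_mult continuous_on_powr' continuous_on_\<delta> continuous_on_norm continuous_on_const) auto
qed

section \<open>Upper estimate: the derivative term\<close>

text \<open>The derivative bound is used on the disc of radius \<open>\<delta> z / 2\<close>, where
  \<open>\<delta>\<close> is comparable to \<open>\<delta> z\<close>. After Tonelli, a fixed
  \<open>w\<close> sees only \<open>z\<close> in \<open>ball w (\<delta> w)\<close>, whose area
  restores the exponent 2 that was lost.\<close>

lemma nn_integral_deriv_le:
  fixes g :: "complex \<Rightarrow> complex" and \<alpha> :: real
  assumes g: "g holomorphic_on \<Omega>" and p: "1 < p"
  shows "(\<integral>\<^sup>+z\<in>\<Omega>. ennreal (norm (deriv g z) powr p * \<delta> z powr (\<alpha> + p)) \<partial>lborel)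
    \<le> ennreal (64 * 4 powr p * 2 powr (p + 2) * 2 powr \<bar>\<alpha> - 2\<bar> * pi) *
       (\<integral>\<^sup>+z\<in>\<Omega>. ennreal (norm (g z) powr p * \<delta> z powr \<alpha>) \<partial>lborel)"
proof -
  \<comment> \<open>The exponent is \<open>\<alpha> + p\<close> reduced by the \<open>p + 2\<close>
    of the derivative bound.\<close>
  define G where "G = (\<lambda>w. ennreal (norm (g w) powr p * \<delta> w powr (\<alpha> - 2)) * indicator \<Omega> w)"
  have [measurable]: "G \<in> borel_measurable borel"
    unfolding G_def using g p by (intro borel_measurable_weighted holomorphic_on_imp_continuous_on)
  define k :: "complex \<Rightarrow> complex \<Rightarrow> ennreal"
    where "k = (\<lambda>z w. if z \<in> \<Omega> \<and> dist z w < \<delta> z / 2 then 1 else 0)"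
  have [measurable]: "case_prod k \<in> borel_measurable (borel \<Otimes>\<^sub>M borel)"
    unfolding k_def by measurable
  define C1 where "C1 = 64 * 4 powr p * 2 powr (p + 2)"
  define C2 where "C2 = 2 powr \<bar>\<alpha> - 2\<bar>"
  have C: "C1 \<ge> 0" "C2 \<ge> 0" by (auto simp: C1_def C2_def)
  have near: "\<delta> z \<le> 2 * \<delta> w" "\<delta> w \<le> 2 * \<delta> z" "w \<in> \<Omega>" if "z \<in> \<Omega>" "dist z w < \<delta> z / 2" for z w
    using that \<delta>_le[of z w] \<delta>_le[of w z] \<delta>_pos[of z] ball_\<delta>_subset[of z "\<delta> z / 2"]
    by (auto simp: dist_commute)
  have pt: "ennreal (norm (deriv g z) powr p * \<delta> z powr (\<alpha> + p))
       \<le> ennreal (C1 * C2) * (\<integral>\<^sup>+w. k z w * G w \<partial>lborel)" if z: "z \<in> \<Omega>" for z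
  proof -
    have d: "\<delta> z > 0" using z \<delta>_pos by auto
    have sub: "ball z (\<delta> z / 2) \<subseteq> \<Omega>" using z d by (intro ball_\<delta>_subset) auto
    have "\<delta> z powr (\<alpha> + p) = 2 powr (p + 2) * \<delta> z powr (\<alpha> - 2) * (\<delta> z / 2) powr (p + 2)"
      using d by (simp add: powr_divide flip: powr_add)
    then have "ennreal (norm (deriv g z) powr p * \<delta> z powr (\<alpha> + p))
      = ennreal (2 powr (p + 2) * \<delta> z powr (\<alpha> - 2)) *
        ennreal (norm (deriv g z) powr p * (\<delta> z / 2) powr (p + 2))"
      by (simp add: ennreal_mult[symmetric] mult_ac)
    also have "\<dots> \<le> ennreal (2 powr (p + 2) * \<delta> z powr (\<alpha> - 2)) * (ennreal (64 * 4 powr p) *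
        (\<integral>\<^sup>+x\<in>ball z (\<delta> z / 2). ennreal (norm (g x) powr p) \<partial>lborel))"
      using d p by (intro mult_left_mono norm_deriv_powr_le_nn_integral holomorphic_on_subset[OF g sub]) auto
    also have "\<dots> = ennreal C1 * (ennreal (\<delta> z powr (\<alpha> - 2)) *
        (\<integral>\<^sup>+x\<in>ball z (\<delta> z / 2). ennreal (norm (g x) powr p) \<partial>lborel))"
      by (simp add: C1_def ennreal_mult mult_ac)
    also have "ennreal (\<delta> z powr (\<alpha> - 2)) *
        (\<integral>\<^sup>+x\<in>ball z (\<delta> z / 2). ennreal (norm (g x) powr p) \<partial>lborel)
      = (\<integral>\<^sup>+x. ennreal (\<delta> z powr (\<alpha> - 2)) * (ennreal (norm (g x) powr p) * indicator (ball z (\<delta> z / 2)) x) \<partial>lborel)"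
    proof (rule nn_integral_cmult[symmetric])
      have "(\<lambda>x. ennreal (norm (g x) powr p) * indicator (ball z (\<delta> z / 2)) x) \<in> borel_measurable borel"
        using p by (intro borel_measurable_continuous_on_open_ennreal continuous_on_powr' continuous_intros
          holomorphic_on_imp_continuous_on holomorphic_on_subset[OF g sub]) auto
      then show "(\<lambda>x. ennreal (norm (g x) powr p) * indicator (ball z (\<delta> z / 2)) x) \<in> borel_measurable lborel"
        by simp
    qed
    also have "\<dots> \<le> (\<integral>\<^sup>+w. ennreal C2 * (k z w * G w) \<partial>lborel)"
    proof (intro nn_integral_mono)
      fix w
      show "ennreal (\<delta> z powr (\<alpha> - 2)) * (ennreal (norm (g w) powr p) * indicator (ball z (\<delta> z / 2)) w)
          \<le> ennreal C2 * (k z w * G w)"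
      proof (cases "dist z w < \<delta> z / 2")
        case True
        have "\<delta> z powr (\<alpha> - 2) \<le> C2 * \<delta> w powr (\<alpha> - 2)"
          unfolding C2_def using near[OF z True] d \<delta>_pos by (intro powr_comparable) auto
        then have "\<delta> z powr (\<alpha> - 2) * norm (g w) powr p \<le> C2 * \<delta> w powr (\<alpha> - 2) * norm (g w) powr p"
          by (intro mult_right_mono) auto
        then show ?thesis using True near[OF z True] z C
          by (simp add: k_def G_def ennreal_mult[symmetric] mult_ac)
      qed auto
    qed
    also have "\<dots> = ennreal C2 * (\<integral>\<^sup>+w. k z w * G w \<partial>lborel)"
      by (intro nn_integral_cmult) measurable
    finally show ?thesis using C by (simp add: ennreal_mult mult_left_mono mult.assoc)
  qed
  have inner: "G w * (\<integral>\<^sup>+z. k z w \<partial>lborel) \<le> ennreal pi * (ennreal (norm (g w) powr p * \<delta> w powr \<alpha>) * indicator \<Omega> w)" for w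
  proof (cases "w \<in> \<Omega>")
    case True
    have "(\<integral>\<^sup>+z. k z w \<partial>lborel) \<le> (\<integral>\<^sup>+z. indicator (ball w (\<delta> w)) z \<partial>lborel)"
      using near(1) by (intro nn_integral_mono) (fastforce simp: k_def dist_commute split: split_indicator)
    also have "\<dots> = ennreal (pi * (\<delta> w)\<^sup>2)"
      using \<delta>_nonneg by (simp add: emeasure_ball_complex)
    finally have "G w * (\<integral>\<^sup>+z. k z w \<partial>lborel) \<le> G w * ennreal (pi * (\<delta> w)\<^sup>2)"
      by (rule mult_left_mono) simp
    also have "\<dots> = ennreal (pi * (norm (g w) powr p * (\<delta> w powr (\<alpha> - 2) * \<delta> w powr 2)))"
      using True \<delta>_pos[OF True] by (simp add: G_def ennreal_mult[symmetric] mult_ac)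
    also have "\<delta> w powr (\<alpha> - 2) * \<delta> w powr 2 = \<delta> w powr \<alpha>"
      by (simp flip: powr_add)
    finally show ?thesis using True by (simp add: ennreal_mult)
  qed (simp add: G_def)
  have "(\<integral>\<^sup>+z\<in>\<Omega>. ennreal (norm (deriv g z) powr p * \<delta> z powr (\<alpha> + p)) \<partial>lborel)
    \<le> (\<integral>\<^sup>+z. ennreal (C1 * C2) * (\<integral>\<^sup>+w. k z w * G w \<partial>lborel) \<partial>lborel)"
    by (intro nn_integral_mono) (use pt in \<open>auto split: split_indicator\<close>)
  also have "\<dots> = ennreal (C1 * C2) * (\<integral>\<^sup>+z. (\<integral>\<^sup>+w. k z w * G w \<partial>lborel) \<partial>lborel)"
    by (intro nn_integral_cmult) measurable
  also have "(\<integral>\<^sup>+z. (\<integral>\<^sup>+w. k z w * G w \<partial>lborel) \<partial>lborel) = (\<integral>\<^sup>+w. (\<integral>\<^sup>+z. k z w * G w \<partial>lborel) \<partial>lborel)"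
    by (intro lborel_pair.Fubini') measurable
  also have "\<dots> = (\<integral>\<^sup>+w. G w * (\<integral>\<^sup>+z. k z w \<partial>lborel) \<partial>lborel)"
    by (intro nn_integral_cong, subst nn_integral_multc) (measurable, simp add: mult.commute)
  also have "\<dots> \<le> (\<integral>\<^sup>+w. ennreal pi * (ennreal (norm (g w) powr p * \<delta> w powr \<alpha>) * indicator \<Omega> w) \<partial>lborel)"
    by (intro nn_integral_mono inner)
  also have "\<dots> = ennreal pi * (\<integral>\<^sup>+w\<in>\<Omega>. ennreal (norm (g w) powr p * \<delta> w powr \<alpha>) \<partial>lborel)"
    using borel_measurable_weighted[OF holomorphic_on_imp_continuous_on[OF g] p, of \<alpha>]
    by (intro nn_integral_cmult) auto
  finally show ?thesis
    using C by (simp add: C1_def C2_def ennreal_mult mult_left_mono mult.assoc)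
qed

section \<open>Lower estimate: John curves and shadows\<close>

text \<open>The constant \<open>K\<close> precedes the quantifiers over \<open>g\<close>,
  \<open>\<gamma>\<close> and \<open>l\<close>, so one \<open>K\<close> serves all curves and
  functions. Points \<open>w\<close> near \<open>\<gamma> t\<close> satisfy
  \<open>c * t \<le> 2 * \<delta> w\<close>; this bounds both the time the curve spends near
  \<open>w\<close> and the distance from its start to \<open>w\<close>, which is where the factor
  \<open>2 / c + 1\<close> comes from.\<close>

lemma norm_diff_powr_le_shadow:
  fixes p \<kappa> c :: real
  assumes p: "1 < p" and \<kappa>: "0 < \<kappa>" and c: "0 < c"
  obtains K where "0 < K"
    "\<forall>g \<gamma> l. g holomorphic_on \<Omega> \<and> 0 \<le> l \<and> continuous_on {0..l} \<gamma> \<and> \<gamma> ` {0..l} \<subseteq> \<Omega> \<and>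
       (\<forall>s t. 0 \<le> s \<and> s \<le> t \<and> t \<le> l \<longrightarrow> dist (\<gamma> s) (\<gamma> t) \<le> t - s) \<and>
       (\<forall>t\<in>{0..l}. c * t \<le> \<delta> (\<gamma> t)) \<longrightarrow>
       ennreal (norm (g (\<gamma> l) - g (\<gamma> 0)) powr p) \<le> ennreal (K * \<delta> (\<gamma> 0) powr (- \<kappa>)) *
         (\<integral>\<^sup>+z. (if dist (\<gamma> 0) z \<le> (2 / c + 1) * \<delta> z then 1 else 0) *
            (ennreal (norm (deriv g z) powr p * \<delta> z powr (p - 2 + \<kappa>)) * indicator \<Omega> z) \<partial>lborel)"
proof -
  \<comment> \<open>With this \<open>m\<close> the weight \<open>(t + d) powr (- 1 - 1 / m)\<close>
    has \<open>(p - 1)\<close>-th power of its integral of order \<open>d powr (- \<kappa>)\<close>,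
    and its own power \<open>1 - p\<close> is \<open>(t + d) powr e\<close>.\<close>
  define m where "m = (p - 1) / \<kappa>"
  have m: "m > 0" using p \<kappa> by (simp add: m_def)
  define e where "e = p - 1 + \<kappa>"
  have e: "e > 0" using p \<kappa> by (simp add: e_def)
  \<comment> \<open>Since \<open>\<delta>\<close> is 1-Lipschitz,
    \<open>d \<le> \<delta> (\<gamma> t) + t\<close>; with
    \<open>t \<le> \<delta> (\<gamma> t) / c\<close> this gives
    \<open>t + d \<le> A * \<delta> (\<gamma> t)\<close>.\<close>
  define A where "A = 1 + 2 / c"
  have A: "A > 0" using c by (simp add: A_def add_pos_pos)
  define K1 where "K1 = A powr e * 16 * (16 * 2 powr p)"
  define K2 where "K2 = 2 powr \<bar>e - 2\<bar>"
  have K12: "K1 > 0" "K2 > 0" using A by (auto simp: K1_def K2_def)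
  define K where "K = m powr (p - 1) * (K1 * K2 * (2 / c))"
  have K: "K > 0" using m K12 c by (simp add: K_def)
  show ?thesis
  proof (rule that[OF K], intro allI impI, elim conjE)
    fix g :: "complex \<Rightarrow> complex" and \<gamma> :: "real \<Rightarrow> complex" and l :: real
    assume g: "g holomorphic_on \<Omega>" and l: "0 \<le> l" and c\<gamma>: "continuous_on {0..l} \<gamma>"
      and \<gamma>\<Omega>: "\<gamma> ` {0..l} \<subseteq> \<Omega>"
      and lip': "\<forall>s t. 0 \<le> s \<and> s \<le> t \<and> t \<le> l \<longrightarrow> dist (\<gamma> s) (\<gamma> t) \<le> t - s"
      and john: "\<forall>t\<in>{0..l}. c * t \<le> \<delta> (\<gamma> t)"
    have lip: "dist (\<gamma> s) (\<gamma> t) \<le> t - s" if "0 \<le> s" "s \<le> t" "t \<le> l" for s t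
      using lip' that by blast
    define x where "x = \<gamma> 0"
    have x: "x \<in> \<Omega>" using \<gamma>\<Omega> l by (auto simp: x_def)
    define d where "d = \<delta> x"
    have d: "d > 0" using x \<delta>_pos by (simp add: d_def)
    have dg: "deriv g holomorphic_on \<Omega>" using g open_\<Omega> by (rule holomorphic_deriv)
    define H where "H = (\<lambda>z. (if dist x z \<le> (2 / c + 1) * \<delta> z then 1 else 0) *
            (ennreal (norm (deriv g z) powr p * \<delta> z powr (p - 2 + \<kappa>)) * indicator \<Omega> z))"
    have [measurable]: "(\<lambda>z. ennreal (norm (deriv g z) powr p * \<delta> z powr q) * indicator \<Omega> z) \<in> borel_measurable borel" for q
      using dg p by (intro borel_measurable_weighted holomorphic_on_imp_continuous_on)
    have [measurable]: "H \<in> borel_measurable borel" unfolding H_def by measurable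
    have "ennreal (norm (g (\<gamma> l) - g x) powr p) \<le> ennreal (K * d powr (- \<kappa>)) * (\<integral>\<^sup>+z. H z \<partial>lborel)"
    \<comment> \<open>A constant curve makes the left side 0; the power mean inequality asks for an
      interval of positive length.\<close>
    proof (cases "l = 0")
      case True
      then show ?thesis by (simp add: x_def)
    next
      case False
      then have l0: "0 < l" using l by simp
      define u where "u = (\<lambda>t. norm (deriv g (\<gamma> t)))"
      define v where "v = (\<lambda>t::real. (t + d) powr (- 1 - 1 / m))"
      have cu: "continuous_on {0..l} u" and path: "norm (g (\<gamma> l) - g x) \<le> integral {0..l} u"
        unfolding u_def x_def using norm_diff_le_integral_deriv_path[OF g open_\<Omega> l \<gamma>\<Omega> lip c\<gamma>] by auto
      have u0: "u t \<ge> 0" for t by (simp add: u_def)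
      have td: "t + d > 0" if "t \<in> {0..l}" for t using that d by auto
      have v0: "v t > 0" if "t \<in> {0..l}" for t using td[OF that] by (simp add: v_def)
      have cv: "continuous_on {0..l} v"
        unfolding v_def using td by (intro continuous_intros) force
      have vv: "v t powr (1 - p) = (t + d) powr e" if "t \<in> {0..l}" for t
      proof -
        have "(- 1 - 1 / m) * (1 - p) = (p - 1) + (p - 1) / m"
          by (simp add: left_diff_distrib right_diff_distrib diff_divide_distrib)
        also have "(p - 1) / m = \<kappa>" using p \<kappa> by (simp add: m_def)
        finally show ?thesis by (simp add: v_def powr_powr e_def)
      qed
      define W where "W = (\<lambda>t. u t powr p * (t + d) powr e)"
      have cW: "continuous_on {0..l} W"
        unfolding W_def using td u0 p
        by (intro continuous_on_mult continuous_on_powr' cu continuous_on_add continuous_on_id continuous_on_const)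
          (auto simp: e less_imp_le)
      have W0: "W t \<ge> 0" for t by (simp add: W_def)
      have iv: "integral {0..l} v \<ge> 0"
        using v0 by (intro integral_nonneg integrable_continuous_real cv) (auto intro: less_imp_le)
      have "norm (g (\<gamma> l) - g x) powr p \<le> integral {0..l} u powr p"
        using p by (intro powr_mono2 path) auto
      also have "\<dots> \<le> integral {0..l} v powr (p - 1) * integral {0..l} (\<lambda>t. u t powr p * v t powr (1 - p))"
        using u0 v0 by (intro weighted_power_mean p l0 cu cv) auto
      also have "integral {0..l} (\<lambda>t. u t powr p * v t powr (1 - p)) = integral {0..l} W"
        unfolding W_def by (intro integral_cong) (simp add: vv)
      also have "integral {0..l} v powr (p - 1) \<le> (m * d powr (- 1 / m)) powr (p - 1)"
        unfolding v_def using p iv[unfolded v_def] by (intro powr_mono2 integral_powr_shift_le d l m) auto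
      also have "\<dots> = m powr (p - 1) * d powr (- \<kappa>)"
      proof -
        have "- 1 / m * (p - 1) = - \<kappa>" using p \<kappa> by (simp add: m_def)
        then show ?thesis by (simp only: powr_mult powr_powr)
      qed
      finally have "norm (g (\<gamma> l) - g x) powr p \<le> m powr (p - 1) * d powr (- \<kappa>) * integral {0..l} W"
        using W0 by (simp add: mult_right_mono integral_nonneg integrable_continuous_real cW)
      then have "ennreal (norm (g (\<gamma> l) - g x) powr p) \<le> ennreal (m powr (p - 1) * d powr (- \<kappa>)) * ennreal (integral {0..l} W)"
        using W0 by (simp add: ennreal_mult[symmetric] integral_nonneg integrable_continuous_real cW)
      also have "ennreal (integral {0..l} W) = (\<integral>\<^sup>+t\<in>{0..l}. ennreal (W t) \<partial>lborel)"
        by (rule nn_integral_continuous_on_Icc[symmetric, OF cW W0])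
      also have "\<dots> \<le> ennreal (K1 * K2 * (2 / c)) * (\<integral>\<^sup>+z. H z \<partial>lborel)"
      proof -
        \<comment> \<open>The sub-mean value property lowers the exponent \<open>e\<close> by 2;
          integrating over the times near \<open>w\<close> adds 1 again, and
          \<open>e - 1 = p - 2 + \<kappa>\<close>.\<close>
        define G where "G = (\<lambda>w. ennreal (norm (deriv g w) powr p * \<delta> w powr (e - 2)) * indicator \<Omega> w)"
        have [measurable]: "G \<in> borel_measurable borel" unfolding G_def by measurable
        \<comment> \<open>Clamping the parameter extends \<open>\<gamma>\<close> continuously to the
          whole line, so that the kernel \<open>k\<close> is jointly measurable.\<close>
        define \<phi> where "\<phi> = (\<lambda>t. \<gamma> (max 0 (min l t)))"
        have "continuous_on UNIV \<phi>"
          unfolding \<phi>_def using l by (intro continuous_on_compose2[OF c\<gamma>] continuous_intros) auto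
        then have [measurable]: "\<phi> \<in> borel_measurable borel" by (rule borel_measurable_continuous_onI)
        have \<phi>: "\<phi> t = \<gamma> t" if "t \<in> {0..l}" for t using that by (simp add: \<phi>_def)
        define k :: "real \<Rightarrow> complex \<Rightarrow> ennreal"
          where "k = (\<lambda>t w. if t \<in> {0..l} \<and> dist (\<phi> t) w < \<delta> (\<phi> t) / 4 then 1 else 0)"
        have [measurable]: "case_prod k \<in> borel_measurable (borel \<Otimes>\<^sub>M borel)"
          unfolding k_def by measurable
        have near: "\<delta> (\<gamma> t) \<le> 2 * \<delta> w" "\<delta> w \<le> 2 * \<delta> (\<gamma> t)" "w \<in> \<Omega>"
          if "t \<in> {0..l}" "dist (\<gamma> t) w < \<delta> (\<gamma> t) / 4" for t w
        proof -
          have "\<gamma> t \<in> \<Omega>" using \<gamma>\<Omega> that by auto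
          then show "\<delta> (\<gamma> t) \<le> 2 * \<delta> w" "\<delta> w \<le> 2 * \<delta> (\<gamma> t)" "w \<in> \<Omega>"
            using that \<delta>_le[of "\<gamma> t" w] \<delta>_le[of w "\<gamma> t"] \<delta>_pos[of "\<gamma> t"] ball_\<delta>_subset[of "\<gamma> t" "\<delta> (\<gamma> t) / 4"]
            by (auto simp: dist_commute)
        qed
        have pt: "ennreal (W t) \<le> ennreal (K1 * K2) * (\<integral>\<^sup>+w. k t w * G w \<partial>lborel)" if t: "t \<in> {0..l}" for t
        proof -
          define y where "y = \<gamma> t"
          have y: "y \<in> \<Omega>" "\<phi> t = y" using \<gamma>\<Omega> t \<phi> by (auto simp: y_def)
          have dy: "\<delta> y > 0" using y \<delta>_pos by simp
          have sub: "ball y (\<delta> y / 4) \<subseteq> \<Omega>" using y dy by (intro ball_\<delta>_subset) auto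
          have "t + d \<le> A * \<delta> y"
          proof -
            have "t \<le> \<delta> y / c" using bspec[OF john, of t] t c by (simp add: y_def field_simps)
            moreover have "d \<le> \<delta> y + t"
              using \<delta>_le[of x y] lip[of 0 t] t by (simp add: d_def x_def y_def)
            ultimately have "t + d \<le> \<delta> y + 2 * (\<delta> y / c)" by linarith
            then show ?thesis by (simp add: A_def algebra_simps)
          qed
          then have "(t + d) powr e \<le> (A * \<delta> y) powr e"
            using td[OF t] e by (intro powr_mono2) auto
          also have "\<dots> = A powr e * (\<delta> y powr (e - 2) * \<delta> y powr 2)"
            by (simp add: powr_mult flip: powr_add)
          also have "\<dots> = A powr e * 16 * \<delta> y powr (e - 2) * (\<delta> y / 4)\<^sup>2"
            using dy by (simp add: power_divide)
          finally have "W t \<le> u t powr p * (A powr e * 16 * \<delta> y powr (e - 2) * (\<delta> y / 4)\<^sup>2)"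
            unfolding W_def by (intro mult_left_mono) auto
          then have "ennreal (W t) \<le> ennreal (A powr e * 16 * \<delta> y powr (e - 2)) *
              ennreal (norm (deriv g y) powr p * (\<delta> y / 4)\<^sup>2)"
            by (simp add: ennreal_mult[symmetric] ennreal_leI u_def y_def mult_ac)
          also have "\<dots> \<le> ennreal (A powr e * 16 * \<delta> y powr (e - 2)) * (ennreal (16 * 2 powr p) *
              (\<integral>\<^sup>+w\<in>ball y (\<delta> y / 4). ennreal (norm (deriv g w) powr p) \<partial>lborel))"
            using dy by (intro mult_left_mono submean_norm_powr p holomorphic_on_subset[OF dg sub]) auto
          also have "\<dots> = ennreal K1 * (ennreal (\<delta> y powr (e - 2)) *
              (\<integral>\<^sup>+w\<in>ball y (\<delta> y / 4). ennreal (norm (deriv g w) powr p) \<partial>lborel))"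
            by (simp add: K1_def ennreal_mult mult_ac)
          also have "ennreal (\<delta> y powr (e - 2)) * (\<integral>\<^sup>+w\<in>ball y (\<delta> y / 4). ennreal (norm (deriv g w) powr p) \<partial>lborel)
             = (\<integral>\<^sup>+w. ennreal (\<delta> y powr (e - 2)) * (ennreal (norm (deriv g w) powr p) * indicator (ball y (\<delta> y / 4)) w) \<partial>lborel)"
          proof (rule nn_integral_cmult[symmetric])
            have "(\<lambda>w. ennreal (norm (deriv g w) powr p) * indicator (ball y (\<delta> y / 4)) w) \<in> borel_measurable borel"
              using p by (intro borel_measurable_continuous_on_open_ennreal continuous_on_powr' continuous_intros
                holomorphic_on_imp_continuous_on holomorphic_on_subset[OF dg sub]) auto
            then show "(\<lambda>w. ennreal (norm (deriv g w) powr p) * indicator (ball y (\<delta> y / 4)) w) \<in> borel_measurable lborel"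
              by simp
          qed
          also have "\<dots> \<le> (\<integral>\<^sup>+w. ennreal K2 * (k t w * G w) \<partial>lborel)"
          proof (intro nn_integral_mono)
            fix w
            show "ennreal (\<delta> y powr (e - 2)) * (ennreal (norm (deriv g w) powr p) * indicator (ball y (\<delta> y / 4)) w)
                \<le> ennreal K2 * (k t w * G w)"
            proof (cases "dist y w < \<delta> y / 4")
              case True
              note nw = near[OF t, of w, folded y_def, OF True]
              have "\<delta> y powr (e - 2) \<le> K2 * \<delta> w powr (e - 2)"
                unfolding K2_def using nw dy \<delta>_pos by (intro powr_comparable) auto
              then have "\<delta> y powr (e - 2) * norm (deriv g w) powr p \<le> K2 * \<delta> w powr (e - 2) * norm (deriv g w) powr p"
                by (intro mult_right_mono) auto
              then show ?thesis using True nw t y K12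
                by (simp add: k_def G_def ennreal_mult[symmetric] mult_ac)
            qed auto
          qed
          also have "\<dots> = ennreal K2 * (\<integral>\<^sup>+w. k t w * G w \<partial>lborel)"
            by (intro nn_integral_cmult) measurable
          finally show ?thesis using K12 by (simp add: ennreal_mult mult_left_mono mult.assoc)
        qed
        have inner: "G w * (\<integral>\<^sup>+t. k t w \<partial>lborel) \<le> ennreal (2 / c) * H w" for w
        proof (cases "w \<in> \<Omega> \<and> (\<exists>t. k t w \<noteq> 0)")
          case True
          then have w: "w \<in> \<Omega>" by auto
          have dw: "\<delta> w > 0" using w \<delta>_pos by simp
          have kt: "0 \<le> t" "t \<le> 2 / c * \<delta> w" "dist x w \<le> (2 / c + 1) * \<delta> w" if "k t w \<noteq> 0" for t
          proof -
            have t: "t \<in> {0..l}" "dist (\<gamma> t) w < \<delta> (\<gamma> t) / 4"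
              using that \<phi> by (auto simp: k_def split: if_splits)
            note nw = near[OF t]
            show "0 \<le> t" using t by simp
            have "c * t \<le> 2 * \<delta> w" using bspec[OF john, of t] t nw by auto
            then show *: "t \<le> 2 / c * \<delta> w" using c by (simp add: field_simps)
            have "dist x w \<le> t + \<delta> (\<gamma> t) / 4"
              using dist_triangle[of x w "\<gamma> t"] lip[of 0 t] t by (simp add: x_def)
            also have "\<dots> \<le> 2 / c * \<delta> w + \<delta> w" using * nw dw by linarith
            finally show "dist x w \<le> (2 / c + 1) * \<delta> w" by (simp add: distrib_right)
          qed
          have dist: "dist x w \<le> (2 / c + 1) * \<delta> w" using True kt by auto
          have "(\<integral>\<^sup>+t. k t w \<partial>lborel) \<le> (\<integral>\<^sup>+t. indicator {0..2 / c * \<delta> w} t \<partial>lborel)"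
          proof (intro nn_integral_mono)
            fix t
            show "k t w \<le> indicator {0..2 / c * \<delta> w} t"
              using kt[of t] by (cases "k t w = 0") (auto simp: k_def)
          qed
          also have "\<dots> = ennreal (2 / c * \<delta> w)"
            using c dw by simp
          finally have "G w * (\<integral>\<^sup>+t. k t w \<partial>lborel) \<le> G w * ennreal (2 / c * \<delta> w)"
            by (rule mult_left_mono) simp
          also have "\<dots> = ennreal (2 / c * (norm (deriv g w) powr p * (\<delta> w powr (e - 2) * \<delta> w powr 1)))"
            using w dw c by (simp add: G_def ennreal_mult[symmetric] mult_ac)
          also have "\<delta> w powr (e - 2) * \<delta> w powr 1 = \<delta> w powr (p - 2 + \<kappa>)"
            unfolding powr_add[symmetric] by (simp add: e_def algebra_simps)
          finally show ?thesis using w dist c by (simp add: H_def ennreal_mult[symmetric])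
        qed (auto simp: G_def)
        have "(\<integral>\<^sup>+t\<in>{0..l}. ennreal (W t) \<partial>lborel)
          \<le> (\<integral>\<^sup>+t. ennreal (K1 * K2) * (\<integral>\<^sup>+w. k t w * G w \<partial>lborel) \<partial>lborel)"
          by (intro nn_integral_mono) (use pt in \<open>auto split: split_indicator\<close>)
        also have "\<dots> = ennreal (K1 * K2) * (\<integral>\<^sup>+t. (\<integral>\<^sup>+w. k t w * G w \<partial>lborel) \<partial>lborel)"
          by (intro nn_integral_cmult) measurable
        also have "(\<integral>\<^sup>+t. (\<integral>\<^sup>+w. k t w * G w \<partial>lborel) \<partial>lborel) = (\<integral>\<^sup>+w. (\<integral>\<^sup>+t. k t w * G w \<partial>lborel) \<partial>lborel)"
          by (intro lborel_pair.Fubini') measurable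
        also have "\<dots> = (\<integral>\<^sup>+w. G w * (\<integral>\<^sup>+t. k t w \<partial>lborel) \<partial>lborel)"
          by (intro nn_integral_cong, subst nn_integral_multc) (measurable, simp add: mult.commute)
        also have "\<dots> \<le> (\<integral>\<^sup>+w. ennreal (2 / c) * H w \<partial>lborel)"
          by (intro nn_integral_mono inner)
        also have "\<dots> = ennreal (2 / c) * (\<integral>\<^sup>+w. H w \<partial>lborel)"
          by (intro nn_integral_cmult) measurable
        finally show ?thesis
          using K12 c by (simp add: ennreal_mult mult.assoc mult_left_mono del: times_divide_eq_right)
      qed
      finally show ?thesis
        using K12 c by (simp add: K_def ennreal_mult mult_ac mult_right_mono del: times_divide_eq_right times_divide_eq_left)
    qed
    then show "ennreal (norm (g (\<gamma> l) - g (\<gamma> 0)) powr p) \<le> ennreal (K * \<delta> (\<gamma> 0) powr (- \<kappa>)) *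
         (\<integral>\<^sup>+z. (if dist (\<gamma> 0) z \<le> (2 / c + 1) * \<delta> z then 1 else 0) *
            (ennreal (norm (deriv g z) powr p * \<delta> z powr (p - 2 + \<kappa>)) * indicator \<Omega> z) \<partial>lborel)"
      by (simp add: x_def d_def H_def)
  qed
qed

text \<open>The shadow of \<open>z\<close> lies in the closed disc of radius
  \<open>(M + 1) * \<delta> z\<close> about a nearest boundary point, where the estimate for powers
  of the distance to the boundary applies.\<close>

lemma nn_integral_shadow_le:
  assumes dim: "assouad_dim (frontier \<Omega>) < ereal (\<beta> + 2)" and M: "0 \<le> M"
  obtains K where "0 < K" "\<forall>z\<in>\<Omega>.
    (\<integral>\<^sup>+x. (if dist x z \<le> M * \<delta> z then 1 else 0) * (ennreal (\<delta> x powr \<beta>) * indicator \<Omega> x) \<partial>lborel)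
      \<le> ennreal (K * \<delta> z powr (\<beta> + 2))"
proof -
  obtain s C where sC: "0 \<le> s" "s < \<beta> + 2" "0 < C"
    "\<forall>x\<in>frontier \<Omega>. \<forall>r R. 0 < r \<and> r < R \<longrightarrow>
       (\<exists>F. finite F \<and> frontier \<Omega> \<inter> ball x R \<subseteq> (\<Union>c\<in>F. ball c r) \<and> real (card F) \<le> C * (R / r) powr s)"
    by (rule assouad_dim_lessE[OF dim])
  obtain K where K: "0 < K" "\<forall>\<xi>\<in>frontier \<Omega>. \<forall>R>0.
    (\<integral>\<^sup>+x\<in>cball \<xi> R. ennreal (infdist x (frontier \<Omega>) powr \<beta>) \<partial>lborel) \<le> ennreal (K * R powr (\<beta> + 2))"
    by (rule nn_integral_infdist_powr_le[OF frontier_closed frontier_nonempty sC])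
  show ?thesis
  proof (rule that[of "K * (M + 1) powr (\<beta> + 2)"]; (intro ballI)?)
    show "0 < K * (M + 1) powr (\<beta> + 2)" using K M by simp
    fix z assume z: "z \<in> \<Omega>"
    then have d: "\<delta> z > 0" by (rule \<delta>_pos)
    obtain \<xi> where \<xi>: "\<xi> \<in> frontier \<Omega>" "\<delta> z = dist z \<xi>" using nearest_frontier_point by metis
    define R where "R = (M + 1) * \<delta> z"
    have "(\<integral>\<^sup>+x. (if dist x z \<le> M * \<delta> z then 1 else 0) * (ennreal (\<delta> x powr \<beta>) * indicator \<Omega> x) \<partial>lborel)
      \<le> (\<integral>\<^sup>+x\<in>cball \<xi> R. ennreal (infdist x (frontier \<Omega>) powr \<beta>) \<partial>lborel)"
    proof (intro nn_integral_mono)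
      fix x
      have "dist \<xi> x \<le> R" if "dist x z \<le> M * \<delta> z"
        using that dist_triangle[of \<xi> x z] \<xi> by (simp add: R_def dist_commute algebra_simps)
      then show "(if dist x z \<le> M * \<delta> z then 1 else 0) * (ennreal (\<delta> x powr \<beta>) * indicator \<Omega> x)
          \<le> ennreal (infdist x (frontier \<Omega>) powr \<beta>) * indicator (cball \<xi> R) x"
        by (auto simp: bdry_dist_def split: split_indicator)
    qed
    also have "\<dots> \<le> ennreal (K * R powr (\<beta> + 2))"
      using M d by (intro K(2)[rule_format] \<xi>(1)) (simp add: R_def)
    also have "K * R powr (\<beta> + 2) = K * (M + 1) powr (\<beta> + 2) * \<delta> z powr (\<beta> + 2)"
      by (simp add: R_def powr_mult)
    finally show "(\<integral>\<^sup>+x. (if dist x z \<le> M * \<delta> z then 1 else 0) * (ennreal (\<delta> x powr \<beta>) * indicator \<Omega> x) \<partial>lborel)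
      \<le> ennreal (K * (M + 1) powr (\<beta> + 2) * \<delta> z powr (\<beta> + 2))" .
  qed
qed

text \<open>Tonelli moves the weight in \<open>x\<close> inside, where the shadow bound for
  \<open>z\<close> contributes the exponent \<open>\<beta> + 2\<close> on top of
  \<open>q\<close>.\<close>

lemma nn_integral_shadow_swap:
  fixes F :: "complex \<Rightarrow> complex"
  assumes F: "continuous_on \<Omega> F" and p: "1 < p" and K: "0 \<le> K"
    and shadow: "\<And>z. z \<in> \<Omega> \<Longrightarrow>
      (\<integral>\<^sup>+x. (if dist x z \<le> M * \<delta> z then 1 else 0) * (ennreal (\<delta> x powr \<beta>) * indicator \<Omega> x) \<partial>lborel)
        \<le> ennreal (K * \<delta> z powr (\<beta> + 2))"
  shows "(\<integral>\<^sup>+x. (ennreal (\<delta> x powr \<beta>) * indicator \<Omega> x) *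
            (\<integral>\<^sup>+z. (if dist x z \<le> M * \<delta> z then 1 else 0) *
               (ennreal (norm (F z) powr p * \<delta> z powr q) * indicator \<Omega> z) \<partial>lborel) \<partial>lborel)
    \<le> ennreal K * (\<integral>\<^sup>+z\<in>\<Omega>. ennreal (norm (F z) powr p * \<delta> z powr (q + \<beta> + 2)) \<partial>lborel)"
proof -
  define G where "G = (\<lambda>r z. ennreal (norm (F z) powr p * \<delta> z powr r) * indicator \<Omega> z)"
  have [measurable]: "G r \<in> borel_measurable borel" for r
    unfolding G_def by (intro borel_measurable_weighted F p)
  define w where "w = (\<lambda>x. ennreal (\<delta> x powr \<beta>) * indicator \<Omega> x)"
  have [measurable]: "w \<in> borel_measurable borel" unfolding w_def by measurable
  define h :: "complex \<Rightarrow> complex \<Rightarrow> ennreal" where "h = (\<lambda>x z. if dist x z \<le> M * \<delta> z then 1 else 0)"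
  have [measurable]: "case_prod h \<in> borel_measurable (borel \<Otimes>\<^sub>M borel)"
    unfolding h_def by measurable
  have inner: "G q z * (\<integral>\<^sup>+x. h x z * w x \<partial>lborel) \<le> ennreal K * G (q + \<beta> + 2) z" for z
  proof (cases "z \<in> \<Omega>")
    case True
    have "G q z * (\<integral>\<^sup>+x. h x z * w x \<partial>lborel) \<le> G q z * ennreal (K * \<delta> z powr (\<beta> + 2))"
      unfolding h_def w_def by (intro mult_left_mono shadow True) auto
    also have "\<dots> = ennreal (K * (norm (F z) powr p * (\<delta> z powr q * \<delta> z powr (\<beta> + 2))))"
      using True K by (simp add: G_def ennreal_mult[symmetric] mult_ac)
    also have "\<delta> z powr q * \<delta> z powr (\<beta> + 2) = \<delta> z powr (q + \<beta> + 2)"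
      by (simp add: powr_add[symmetric] add.assoc)
    finally show ?thesis using True K by (simp add: G_def ennreal_mult[symmetric])
  qed (simp add: G_def)
  have "(\<integral>\<^sup>+x. w x * (\<integral>\<^sup>+z. h x z * G q z \<partial>lborel) \<partial>lborel)
      = (\<integral>\<^sup>+x. (\<integral>\<^sup>+z. w x * (h x z * G q z) \<partial>lborel) \<partial>lborel)"
    by (intro nn_integral_cong nn_integral_cmult[symmetric]) measurable
  also have "\<dots> = (\<integral>\<^sup>+z. (\<integral>\<^sup>+x. w x * (h x z * G q z) \<partial>lborel) \<partial>lborel)"
    by (intro lborel_pair.Fubini') measurable
  also have "\<dots> = (\<integral>\<^sup>+z. (\<integral>\<^sup>+x. G q z * (h x z * w x) \<partial>lborel) \<partial>lborel)"
    by (simp add: mult_ac)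
  also have "\<dots> = (\<integral>\<^sup>+z. G q z * (\<integral>\<^sup>+x. h x z * w x \<partial>lborel) \<partial>lborel)"
    by (intro nn_integral_cong nn_integral_cmult) measurable
  also have "\<dots> \<le> (\<integral>\<^sup>+z. ennreal K * G (q + \<beta> + 2) z \<partial>lborel)"
    by (intro nn_integral_mono inner)
  also have "\<dots> = ennreal K * (\<integral>\<^sup>+z. G (q + \<beta> + 2) z \<partial>lborel)"
    by (intro nn_integral_cmult) measurable
  finally show ?thesis by (simp add: w_def h_def G_def)
qed

text \<open>If the shadow of \<open>z\<close> contains \<open>z0\<close>, then
  \<open>\<delta> z0 \<le> (M + 1) * \<delta> z\<close>, and boundedness of \<open>\<Omega>\<close>
  bounds \<open>\<delta> z\<close> from above; so any two powers of \<open>\<delta>\<close> are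
  comparable. This adjusts the exponent in the curve estimate started at \<open>z0\<close>, where no
  integration over \<open>x\<close> is available.\<close>

lemma \<delta>_powr_le_on_shadow:
  assumes z0: "z0 \<in> \<Omega>" and M: "0 \<le> M"
  obtains B where "0 < B"
    "\<forall>z\<in>\<Omega>. dist z0 z \<le> M * \<delta> z \<longrightarrow> \<delta> z powr q \<le> B * \<delta> z powr r"
proof -
  have d0: "\<delta> z0 > 0" using z0 by (rule \<delta>_pos)
  obtain b where b: "\<And>z. z \<in> \<Omega> \<Longrightarrow> dist z0 z \<le> b"
    using bounded_\<Omega> bounded_any_center by metis
  have b0: "b \<ge> 0" using b[OF z0] by simp
  define N where "N = max (M + 1) ((\<delta> z0 + b) / \<delta> z0)"
  have N: "N > 0" using M by (auto simp: N_def less_max_iff_disj)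
  show ?thesis
  proof (rule that[of "N powr \<bar>q - r\<bar> * \<delta> z0 powr (q - r)"]; (intro ballI impI)?)
    show "0 < N powr \<bar>q - r\<bar> * \<delta> z0 powr (q - r)" using N d0 by simp
    fix z assume z: "z \<in> \<Omega>" "dist z0 z \<le> M * \<delta> z"
    have d: "\<delta> z > 0" using z by (intro \<delta>_pos)
    have "\<delta> z \<le> (\<delta> z0 + b) / \<delta> z0 * \<delta> z0"
      using \<delta>_le[of z z0] b[OF z(1)] d0 by (simp add: dist_commute)
    also have "\<dots> \<le> N * \<delta> z0" using d0 by (intro mult_right_mono) (auto simp: N_def)
    finally have 1: "\<delta> z \<le> N * \<delta> z0" .
    have "\<delta> z0 \<le> (M + 1) * \<delta> z"
      using \<delta>_le[of z0 z] z by (simp add: distrib_right)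
    also have "\<dots> \<le> N * \<delta> z" using d by (intro mult_right_mono) (auto simp: N_def)
    finally have "\<delta> z powr (q - r) \<le> N powr \<bar>q - r\<bar> * \<delta> z0 powr (q - r)"
      using 1 d d0 by (intro powr_comparable) auto
    then have "\<delta> z powr (q - r) * \<delta> z powr r \<le> N powr \<bar>q - r\<bar> * \<delta> z0 powr (q - r) * \<delta> z powr r"
      by (intro mult_right_mono) auto
    then show "\<delta> z powr q \<le> N powr \<bar>q - r\<bar> * \<delta> z0 powr (q - r) * \<delta> z powr r"
      by (simp flip: powr_add)
  qed
qed

text \<open>The decomposition \<open>g x = g z0 + (g x0 - g z0) - (g x0 - g x)\<close> uses the
  curve estimate twice, at \<open>x\<close> and at \<open>z0\<close>. The first two terms do not
  depend on \<open>x\<close> and only meet the total mass of the weight.\<close>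

lemma nn_integral_le_deriv:
  fixes p \<alpha> c :: real
  assumes c: "0 < c" and p: "1 < p" and z0: "z0 \<in> \<Omega>"
    and john: "\<And>x. x \<in> \<Omega> \<Longrightarrow> \<exists>\<gamma> l. arclength_curve \<gamma> l \<and> \<gamma> ` {0..l} \<subseteq> \<Omega> \<and> \<gamma> 0 = x \<and> \<gamma> l = x0 \<and>
        (\<forall>t\<in>{0..l}. \<delta> (\<gamma> t) \<ge> c * t)"
    and dim: "assouad_dim (frontier \<Omega>) < ereal (\<alpha> + 2)"
  obtains C where "0 < C" "\<forall>g. g holomorphic_on \<Omega> \<longrightarrow>
    (\<integral>\<^sup>+z\<in>\<Omega>. ennreal (norm (g z) powr p * \<delta> z powr \<alpha>) \<partial>lborel)
      \<le> ennreal C * (ennreal (norm (g z0) powr p * \<delta> z0 powr (\<alpha> + 2)) +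
         (\<integral>\<^sup>+z\<in>\<Omega>. ennreal (norm (deriv g z) powr p * \<delta> z powr (\<alpha> + p)) \<partial>lborel))"
proof -
  define M where "M = 2 / c + 1"
  have M: "M \<ge> 0" using c by (simp add: M_def)
  have d0: "\<delta> z0 > 0" using z0 by (rule \<delta>_pos)
  \<comment> \<open>The gap between the dimension and \<open>\<alpha> + 2\<close> is spent here:
    after lowering the weight exponent by \<open>\<kappa>\<close>, the shadow estimate still applies
    because \<open>\<alpha> - \<kappa> + 2 = \<sigma>\<close>.\<close>
  obtain \<sigma> where \<sigma>: "assouad_dim (frontier \<Omega>) < ereal \<sigma>" "\<sigma> < \<alpha> + 2"
    using ereal_dense2[OF dim] by auto
  define \<kappa> where "\<kappa> = \<alpha> + 2 - \<sigma>"
  have \<kappa>: "\<kappa> > 0" using \<sigma> by (simp add: \<kappa>_def)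
  have dim': "assouad_dim (frontier \<Omega>) < ereal ((\<alpha> - \<kappa>) + 2)" using \<sigma> by (simp add: \<kappa>_def)
  obtain K where K: "0 < K"
    "\<forall>g \<gamma> l. g holomorphic_on \<Omega> \<and> 0 \<le> l \<and> continuous_on {0..l} \<gamma> \<and> \<gamma> ` {0..l} \<subseteq> \<Omega> \<and>
       (\<forall>s t. 0 \<le> s \<and> s \<le> t \<and> t \<le> l \<longrightarrow> dist (\<gamma> s) (\<gamma> t) \<le> t - s) \<and>
       (\<forall>t\<in>{0..l}. c * t \<le> \<delta> (\<gamma> t)) \<longrightarrow>
       ennreal (norm (g (\<gamma> l) - g (\<gamma> 0)) powr p) \<le> ennreal (K * \<delta> (\<gamma> 0) powr (- \<kappa>)) *
         (\<integral>\<^sup>+z. (if dist (\<gamma> 0) z \<le> M * \<delta> z then 1 else 0) *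
            (ennreal (norm (deriv g z) powr p * \<delta> z powr (p - 2 + \<kappa>)) * indicator \<Omega> z) \<partial>lborel)"
    by (rule norm_diff_powr_le_shadow[OF p \<kappa> c, folded M_def])
  obtain K' where K': "0 < K'" "\<forall>z\<in>\<Omega>.
    (\<integral>\<^sup>+x. (if dist x z \<le> M * \<delta> z then 1 else 0) * (ennreal (\<delta> x powr (\<alpha> - \<kappa>)) * indicator \<Omega> x) \<partial>lborel)
      \<le> ennreal (K' * \<delta> z powr (\<alpha> - \<kappa> + 2))"
    by (rule nn_integral_shadow_le[OF dim' M])
  obtain B where B: "0 < B"
    "\<forall>z\<in>\<Omega>. dist z0 z \<le> M * \<delta> z \<longrightarrow> \<delta> z powr (p - 2 + \<kappa>) \<le> B * \<delta> z powr (\<alpha> + p)"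
    by (rule \<delta>_powr_le_on_shadow[OF z0 M])
  \<comment> \<open>Finite mass of the weight is another shadow estimate: with
    \<open>b / \<delta> z0\<close> in place of \<open>M\<close>, the shadow of \<open>z0\<close> is
    all of \<open>\<Omega>\<close>.\<close>
  obtain a where a: "0 \<le> a" "(\<integral>\<^sup>+x\<in>\<Omega>. ennreal (\<delta> x powr \<alpha>) \<partial>lborel) \<le> ennreal a"
  proof -
    obtain b where b: "\<And>z. z \<in> \<Omega> \<Longrightarrow> dist z0 z \<le> b"
      using bounded_\<Omega> bounded_any_center by metis
    have "0 \<le> b / \<delta> z0" using b[OF z0] d0 by simp
    then obtain K where K: "0 < K" and le: "\<forall>z\<in>\<Omega>.
      (\<integral>\<^sup>+x. (if dist x z \<le> b / \<delta> z0 * \<delta> z then 1 else 0) *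
        (ennreal (\<delta> x powr \<alpha>) * indicator \<Omega> x) \<partial>lborel) \<le> ennreal (K * \<delta> z powr (\<alpha> + 2))"
      by (rule nn_integral_shadow_le[OF dim])
    note bspec[OF le z0]
    moreover have "(\<integral>\<^sup>+x. (if dist x z0 \<le> b / \<delta> z0 * \<delta> z0 then 1 else 0) *
        (ennreal (\<delta> x powr \<alpha>) * indicator \<Omega> x) \<partial>lborel) = (\<integral>\<^sup>+x\<in>\<Omega>. ennreal (\<delta> x powr \<alpha>) \<partial>lborel)"
      using b d0 by (intro nn_integral_cong) (auto simp: dist_commute split: split_indicator)
    ultimately show ?thesis using K that[of "K * \<delta> z0 powr (\<alpha> + 2)"] by simp
  qed
  \<comment> \<open>\<open>A1\<close> belongs to the value at \<open>z0\<close>, normalised by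
    \<open>\<delta> z0 powr (\<alpha> + 2)\<close>, and \<open>A2\<close> to the difference between
    \<open>x0\<close> and \<open>z0\<close>.\<close>
  define A1 where "A1 = a * \<delta> z0 powr (- (\<alpha> + 2))"
  define A2 where "A2 = a * (K * \<delta> z0 powr (- \<kappa>) * B)"
  have A12: "A1 \<ge> 0" "A2 \<ge> 0" using a K B by (auto simp: A1_def A2_def)
  define C where "C = 3 powr p * (A1 + A2 + K * K')"
  have C: "C > 0" using A12 K K' by (simp add: C_def add_nonneg_pos)
  show ?thesis
  proof (rule that[OF C], intro allI impI)
    fix g :: "complex \<Rightarrow> complex" assume g: "g holomorphic_on \<Omega>"
    have cg: "continuous_on \<Omega> g" using g by (rule holomorphic_on_imp_continuous_on)
    have dg: "continuous_on \<Omega> (deriv g)"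
      using holomorphic_deriv[OF g open_\<Omega>] by (rule holomorphic_on_imp_continuous_on)
    define D where "D = (\<integral>\<^sup>+z\<in>\<Omega>. ennreal (norm (deriv g z) powr p * \<delta> z powr (\<alpha> + p)) \<partial>lborel)"
    define P where "P = ennreal (norm (g z0) powr p * \<delta> z0 powr (\<alpha> + 2))"
    define S where "S = (\<lambda>x. \<integral>\<^sup>+z. (if dist x z \<le> M * \<delta> z then 1 else 0) *
            (ennreal (norm (deriv g z) powr p * \<delta> z powr (p - 2 + \<kappa>)) * indicator \<Omega> z) \<partial>lborel)"
    have [measurable]: "(\<lambda>z. ennreal (norm (deriv g z) powr p * \<delta> z powr q) * indicator \<Omega> z) \<in> borel_measurable borel" for q
      by (intro borel_measurable_weighted dg p)
    have [measurable]: "S \<in> borel_measurable borel" unfolding S_def by measurable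
    have chain: "ennreal (norm (g x0 - g x) powr p) \<le> ennreal (K * \<delta> x powr (- \<kappa>)) * S x" if x: "x \<in> \<Omega>" for x
    proof -
      obtain \<gamma> l where \<gamma>: "arclength_curve \<gamma> l" "\<gamma> ` {0..l} \<subseteq> \<Omega>" "\<gamma> 0 = x" "\<gamma> l = x0"
          "\<And>t. t \<in> {0..l} \<Longrightarrow> c * t \<le> \<delta> (\<gamma> t)"
        using john[OF x] by auto
      have "ennreal (norm (g (\<gamma> l) - g (\<gamma> 0)) powr p) \<le> ennreal (K * \<delta> (\<gamma> 0) powr (- \<kappa>)) * S (\<gamma> 0)"
        unfolding S_def using \<gamma>
        by (intro K(2)[rule_format] conjI allI impI ballI g arclength_curve_dist_le[OF \<gamma>(1)])
          (auto simp: arclength_curve_def)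
      then show ?thesis using \<gamma> by simp
    qed
    have S0: "S z0 \<le> ennreal B * D"
    proof -
      have "S z0 \<le> (\<integral>\<^sup>+z. ennreal B * (ennreal (norm (deriv g z) powr p * \<delta> z powr (\<alpha> + p)) * indicator \<Omega> z) \<partial>lborel)"
        unfolding S_def
      proof (intro nn_integral_mono)
        fix z
        have "norm (deriv g z) powr p * \<delta> z powr (p - 2 + \<kappa>) \<le> B * (norm (deriv g z) powr p * \<delta> z powr (\<alpha> + p))"
          if "z \<in> \<Omega>" "dist z0 z \<le> M * \<delta> z"
          using mult_left_mono[OF B(2)[rule_format, OF that], of "norm (deriv g z) powr p"] by (simp add: mult_ac)
        then show "(if dist z0 z \<le> M * \<delta> z then 1 else 0) *
            (ennreal (norm (deriv g z) powr p * \<delta> z powr (p - 2 + \<kappa>)) * indicator \<Omega> z)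
          \<le> ennreal B * (ennreal (norm (deriv g z) powr p * \<delta> z powr (\<alpha> + p)) * indicator \<Omega> z)"
          using B(1) by (auto simp: ennreal_mult[symmetric] intro!: ennreal_leI split: split_indicator)
      qed
      also have "\<dots> = ennreal B * D"
        unfolding D_def by (intro nn_integral_cmult) measurable
      finally show ?thesis .
    qed
    define w where "w = (\<lambda>x. ennreal (\<delta> x powr \<alpha>) * indicator \<Omega> x)"
    have [measurable]: "w \<in> borel_measurable borel" unfolding w_def by measurable
    define w' where "w' = (\<lambda>x. ennreal (\<delta> x powr (\<alpha> - \<kappa>)) * indicator \<Omega> x)"
    have [measurable]: "w' \<in> borel_measurable borel" unfolding w'_def by measurable
    define P1 where "P1 = ennreal (norm (g z0) powr p)"
    define P2 where "P2 = ennreal (norm (g x0 - g z0) powr p)"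
    have pt: "ennreal (norm (g x) powr p * \<delta> x powr \<alpha>) * indicator \<Omega> x
        \<le> ennreal (3 powr p) * ((P1 + P2) * w x + ennreal K * (w' x * S x))" for x
    proof (cases "x \<in> \<Omega>")
      case True
      have "norm (g x) \<le> norm (g z0) + norm (g x0 - g z0) + norm (g x0 - g x)"
        using norm_triangle_ineq[of "g z0 + (g x0 - g z0)" "- (g x0 - g x)"]
          norm_triangle_ineq[of "g z0" "g x0 - g z0"] norm_minus_cancel[of "g x0 - g x"] by simp
      then have "norm (g x) powr p \<le> (norm (g z0) + norm (g x0 - g z0) + norm (g x0 - g x)) powr p"
        using p by (intro powr_mono2) auto
      also have "\<dots> \<le> 3 powr p * (norm (g z0) powr p + norm (g x0 - g z0) powr p + norm (g x0 - g x) powr p)"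
        using p by (intro powr_add3_le) auto
      finally have "norm (g x) powr p \<le>
          3 powr p * (norm (g z0) powr p + norm (g x0 - g z0) powr p + norm (g x0 - g x) powr p)" .
      then have "ennreal (norm (g x) powr p) \<le> ennreal (3 powr p) * (P1 + P2 + ennreal (norm (g x0 - g x) powr p))"
        unfolding P1_def P2_def
        by (simp add: ennreal_mult[symmetric] ennreal_plus[symmetric] ennreal_leI del: ennreal_plus)
      also have "\<dots> \<le> ennreal (3 powr p) * (P1 + P2 + ennreal (K * \<delta> x powr (- \<kappa>)) * S x)"
        by (intro mult_left_mono add_left_mono chain True) auto
      finally have "ennreal (norm (g x) powr p) * w x
          \<le> ennreal (3 powr p) * (P1 + P2 + ennreal (K * \<delta> x powr (- \<kappa>)) * S x) * w x"
        by (rule mult_right_mono) simp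
      also have "\<dots> = ennreal (3 powr p) * ((P1 + P2) * w x + ennreal K * (ennreal (\<delta> x powr (- \<kappa>)) * w x * S x))"
        using K by (simp add: ennreal_mult distrib_right distrib_left mult_ac)
      also have "ennreal (\<delta> x powr (- \<kappa>)) * w x = w' x"
        using True by (simp add: w_def w'_def ennreal_mult[symmetric] powr_add[symmetric])
      finally show ?thesis using True by (simp add: w_def ennreal_mult)
    qed simp
    have "(\<integral>\<^sup>+z\<in>\<Omega>. ennreal (norm (g z) powr p * \<delta> z powr \<alpha>) \<partial>lborel)
       \<le> (\<integral>\<^sup>+x. ennreal (3 powr p) * ((P1 + P2) * w x + ennreal K * (w' x * S x)) \<partial>lborel)"
      by (intro nn_integral_mono pt)
    also have "\<dots> = ennreal (3 powr p) * ((P1 + P2) * (\<integral>\<^sup>+x. w x \<partial>lborel) + ennreal K * (\<integral>\<^sup>+x. w' x * S x \<partial>lborel))"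
      by (subst nn_integral_cmult, measurable, subst nn_integral_add, measurable,
          subst nn_integral_cmult, measurable, subst nn_integral_cmult, measurable)
    also have "\<dots> \<le> ennreal (3 powr p) * ((ennreal A1 * P + ennreal A2 * D) + ennreal (K * K') * D)"
    proof (intro mult_left_mono add_mono)
      have P1: "P1 = ennreal (\<delta> z0 powr (- (\<alpha> + 2))) * P"
      proof -
        have "\<delta> z0 powr (- (\<alpha> + 2)) * \<delta> z0 powr (\<alpha> + 2) = 1"
          using d0 unfolding powr_add[symmetric] by simp
        then have "norm (g z0) powr p = \<delta> z0 powr (- (\<alpha> + 2)) * (norm (g z0) powr p * \<delta> z0 powr (\<alpha> + 2))"
          by (simp only: mult_ac mult_1_right)
        then show ?thesis unfolding P1_def P_def by (metis ennreal_mult' powr_ge_zero)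
      qed
      have "P1 * (\<integral>\<^sup>+x. w x \<partial>lborel) \<le> P1 * ennreal a"
        using a by (intro mult_left_mono) (auto simp: w_def)
      also have "\<dots> = ennreal A1 * P"
        using a unfolding P1 A1_def by (simp add: ennreal_mult mult_ac)
      finally have 1: "P1 * (\<integral>\<^sup>+x. w x \<partial>lborel) \<le> ennreal A1 * P" .
      have "P2 * (\<integral>\<^sup>+x. w x \<partial>lborel) \<le> (ennreal (K * \<delta> z0 powr (- \<kappa>)) * S z0) * ennreal a"
        unfolding P2_def using a by (intro mult_mono chain z0) (auto simp: w_def)
      also have "\<dots> \<le> (ennreal (K * \<delta> z0 powr (- \<kappa>)) * (ennreal B * D)) * ennreal a"
        by (intro mult_left_mono mult_right_mono S0) auto
      finally have "P2 * (\<integral>\<^sup>+x. w x \<partial>lborel) \<le> ennreal A2 * D"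
        using a K B by (simp add: A2_def ennreal_mult mult_ac)
      then show "(P1 + P2) * (\<integral>\<^sup>+x. w x \<partial>lborel) \<le> ennreal A1 * P + ennreal A2 * D"
        using 1 by (simp add: distrib_right add_mono)
      have "(\<integral>\<^sup>+x. w' x * S x \<partial>lborel) \<le> ennreal K' *
          (\<integral>\<^sup>+z\<in>\<Omega>. ennreal (norm (deriv g z) powr p * \<delta> z powr ((p - 2 + \<kappa>) + (\<alpha> - \<kappa>) + 2)) \<partial>lborel)"
        unfolding w'_def S_def using K' by (intro nn_integral_shadow_swap dg p) (auto dest: bspec)
      also have "(p - 2 + \<kappa>) + (\<alpha> - \<kappa>) + 2 = \<alpha> + p" by simp
      finally have "ennreal K * (\<integral>\<^sup>+x. w' x * S x \<partial>lborel) \<le> ennreal K * (ennreal K' * D)"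
        unfolding D_def by (rule mult_left_mono) simp
      then show "ennreal K * (\<integral>\<^sup>+x. w' x * S x \<partial>lborel) \<le> ennreal (K * K') * D"
        using K K' by (simp add: ennreal_mult mult.assoc)
    qed auto
    also have "\<dots> \<le> ennreal C * (P + D)"
    proof -
      define s where "s = A1 + A2 + K * K'"
      have KK: "0 \<le> K * K'" using K K' by simp
      have s: "0 \<le> s" "C = 3 powr p * s" using A12 KK by (auto simp: s_def C_def)
      have "ennreal A1 * P \<le> ennreal s * P"
        using A12 KK by (intro mult_right_mono ennreal_leI) (auto simp: s_def)
      moreover have "ennreal A2 * D + ennreal (K * K') * D = ennreal (A2 + K * K') * D"
        using A12 KK by (simp only: ennreal_plus distrib_right)
      moreover have "ennreal (A2 + K * K') * D \<le> ennreal s * D"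
        using A12 by (intro mult_right_mono ennreal_leI) (auto simp: s_def)
      ultimately have "ennreal A1 * P + ennreal A2 * D + ennreal (K * K') * D \<le> ennreal s * (P + D)"
        by (simp add: add.assoc distrib_left add_mono)
      then show ?thesis
        unfolding s(2) using s(1) by (simp add: ennreal_mult mult.assoc mult_left_mono)
    qed
    finally show "(\<integral>\<^sup>+z\<in>\<Omega>. ennreal (norm (g z) powr p * \<delta> z powr \<alpha>) \<partial>lborel)
      \<le> ennreal C * (ennreal (norm (g z0) powr p * \<delta> z0 powr (\<alpha> + 2)) +
         (\<integral>\<^sup>+z\<in>\<Omega>. ennreal (norm (deriv g z) powr p * \<delta> z powr (\<alpha> + p)) \<partial>lborel))"
      by (simp add: P_def D_def)
  qed
qed

section \<open>Upper estimate: the value at the base point\<close>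

text \<open>On the disc of radius \<open>\<delta> z0 / 2\<close> the weight is comparable to its
  value at the centre, so the sub-mean value property suffices. The constant found depends only on
  \<open>p\<close> and \<open>\<alpha>\<close>.\<close>

lemma norm_powr_le_nn_integral:
  assumes z0: "z0 \<in> \<Omega>" and p: "1 < p"
  obtains C where "0 < C" "\<forall>g. g holomorphic_on \<Omega> \<longrightarrow>
    ennreal (norm (g z0) powr p * \<delta> z0 powr (\<alpha> + 2))
      \<le> ennreal C * (\<integral>\<^sup>+z\<in>\<Omega>. ennreal (norm (g z) powr p * \<delta> z powr \<alpha>) \<partial>lborel)"
proof -
  define d where "d = \<delta> z0"
  have d: "d > 0" using \<delta>_pos[OF z0] by (simp add: d_def)
  have sub: "ball z0 (d / 2) \<subseteq> \<Omega>" using z0 d by (intro ball_\<delta>_subset) (auto simp: d_def)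
  define C where "C = 4 * (16 * 2 powr p) * 2 powr \<bar>\<alpha>\<bar>"
  show ?thesis
  proof (rule that[of C]; (intro allI impI)?)
    show "0 < C" by (simp add: C_def)
    fix g :: "complex \<Rightarrow> complex" assume g: "g holomorphic_on \<Omega>"
    have "norm (g z0) powr p * d powr (\<alpha> + 2) = 4 * d powr \<alpha> * (norm (g z0) powr p * (d / 2)\<^sup>2)"
      using d by (simp add: powr_add power_divide)
    then have "ennreal (norm (g z0) powr p * d powr (\<alpha> + 2))
        = ennreal (4 * d powr \<alpha>) * ennreal (norm (g z0) powr p * (d / 2)\<^sup>2)"
      by (simp add: ennreal_mult[symmetric])
    also have "\<dots> \<le> ennreal (4 * d powr \<alpha>) * (ennreal (16 * 2 powr p) *
        (\<integral>\<^sup>+z\<in>ball z0 (d / 2). ennreal (norm (g z) powr p) \<partial>lborel))"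
      using d by (intro mult_left_mono submean_norm_powr p holomorphic_on_subset[OF g sub]) auto
    also have "\<dots> = ennreal (4 * (16 * 2 powr p)) * (ennreal (d powr \<alpha>) *
        (\<integral>\<^sup>+z\<in>ball z0 (d / 2). ennreal (norm (g z) powr p) \<partial>lborel))"
      by (simp add: ennreal_mult mult_ac)
    also have "ennreal (d powr \<alpha>) * (\<integral>\<^sup>+z\<in>ball z0 (d / 2). ennreal (norm (g z) powr p) \<partial>lborel)
       = (\<integral>\<^sup>+z. ennreal (d powr \<alpha>) * (ennreal (norm (g z) powr p) * indicator (ball z0 (d / 2)) z) \<partial>lborel)"
    proof (rule nn_integral_cmult[symmetric])
      have "(\<lambda>z. ennreal (norm (g z) powr p) * indicator (ball z0 (d / 2)) z) \<in> borel_measurable borel"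
        using p by (intro borel_measurable_continuous_on_open_ennreal continuous_on_powr' continuous_intros
          holomorphic_on_imp_continuous_on holomorphic_on_subset[OF g sub]) auto
      then show "(\<lambda>z. ennreal (norm (g z) powr p) * indicator (ball z0 (d / 2)) z) \<in> borel_measurable lborel"
        by simp
    qed
    also have "\<dots> \<le> (\<integral>\<^sup>+z. ennreal (2 powr \<bar>\<alpha>\<bar>) * (ennreal (norm (g z) powr p * \<delta> z powr \<alpha>) * indicator \<Omega> z) \<partial>lborel)"
    proof (intro nn_integral_mono)
      fix z
      show "ennreal (d powr \<alpha>) * (ennreal (norm (g z) powr p) * indicator (ball z0 (d / 2)) z)
        \<le> ennreal (2 powr \<bar>\<alpha>\<bar>) * (ennreal (norm (g z) powr p * \<delta> z powr \<alpha>) * indicator \<Omega> z)"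
      proof (cases "z \<in> ball z0 (d / 2)")
        case True
        then have z: "z \<in> \<Omega>" using sub by auto
        have "d powr \<alpha> \<le> 2 powr \<bar>\<alpha>\<bar> * \<delta> z powr \<alpha>"
          using True d \<delta>_pos[OF z] \<delta>_le[of z z0] \<delta>_le[of z0 z]
          by (intro powr_comparable) (auto simp: d_def dist_commute)
        then have "d powr \<alpha> * norm (g z) powr p \<le> 2 powr \<bar>\<alpha>\<bar> * \<delta> z powr \<alpha> * norm (g z) powr p"
          by (intro mult_right_mono) auto
        then show ?thesis using True z by (simp add: ennreal_mult[symmetric] mult_ac)
      qed auto
    qed
    also have "\<dots> = ennreal (2 powr \<bar>\<alpha>\<bar>) * (\<integral>\<^sup>+z\<in>\<Omega>. ennreal (norm (g z) powr p * \<delta> z powr \<alpha>) \<partial>lborel)"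
      using borel_measurable_weighted[OF holomorphic_on_imp_continuous_on[OF g] p, of \<alpha>]
      by (intro nn_integral_cmult) auto
    finally show "ennreal (norm (g z0) powr p * \<delta> z0 powr (\<alpha> + 2))
      \<le> ennreal C * (\<integral>\<^sup>+z\<in>\<Omega>. ennreal (norm (g z) powr p * \<delta> z powr \<alpha>) \<partial>lborel)"
      by (simp add: C_def d_def ennreal_mult mult_left_mono mult.assoc)
  qed
qed

end

theorem theorem1p1:
  fixes \<Omega> :: "complex set" and z0 :: complex and p \<alpha> :: real
  assumes "john_domain \<Omega>"
    and "z0 \<in> \<Omega>"
    and "1 < p"
    and "ereal \<alpha> > assouad_dim (frontier \<Omega>) - 2"
  shows "\<exists>C::real. C \<ge> 1 \<and>
    (\<forall>g :: complex \<Rightarrow> complex. g analytic_on \<Omega> \<longrightarrow>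
      (let I = set_nn_integral lborel \<Omega>
                 (\<lambda>z. ennreal (norm (g z) powr p * bdry_dist \<Omega> z powr \<alpha>));
           J = ennreal (norm (g z0) powr p * bdry_dist \<Omega> z0 powr (\<alpha> + 2))
               + set_nn_integral lborel \<Omega>
                   (\<lambda>z. ennreal (norm (deriv g z) powr p * bdry_dist \<Omega> z powr (\<alpha> + p)))
       in ennreal (inverse C) * I \<le> J \<and> J \<le> ennreal C * I))"
proof -
  interpret bounded_open_set \<Omega>
    using assms(1) by unfold_locales (auto simp: john_domain_def complex_domain_def)
  obtain x0 c where "x0 \<in> \<Omega>" and c: "0 < c" and john: "\<forall>x\<in>\<Omega>. \<exists>\<gamma> l. arclength_curve \<gamma> l \<and>
      \<gamma> ` {0..l} \<subseteq> \<Omega> \<and> \<gamma> 0 = x \<and> \<gamma> l = x0 \<and> (\<forall>t\<in>{0..l}. \<delta> (\<gamma> t) \<ge> c * t)"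
    using assms(1) unfolding john_domain_def by (elim conjE bexE exE) (rule that)
  \<comment> \<open>The dimension is an extended real, so the subtraction of 2 is undone case by
    case.\<close>
  have dim: "assouad_dim (frontier \<Omega>) < ereal (\<alpha> + 2)"
    using assms(4) by (cases "assouad_dim (frontier \<Omega>)") auto
  obtain C1 where C1: "0 < C1" "\<forall>g. g holomorphic_on \<Omega> \<longrightarrow>
    (\<integral>\<^sup>+z\<in>\<Omega>. ennreal (norm (g z) powr p * \<delta> z powr \<alpha>) \<partial>lborel)
      \<le> ennreal C1 * (ennreal (norm (g z0) powr p * \<delta> z0 powr (\<alpha> + 2)) +
         (\<integral>\<^sup>+z\<in>\<Omega>. ennreal (norm (deriv g z) powr p * \<delta> z powr (\<alpha> + p)) \<partial>lborel))"
    by (rule nn_integral_le_deriv[OF c assms(3,2) bspec[OF john] dim])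
  obtain C2 where C2: "0 < C2" "\<forall>g. g holomorphic_on \<Omega> \<longrightarrow>
    ennreal (norm (g z0) powr p * \<delta> z0 powr (\<alpha> + 2))
      \<le> ennreal C2 * (\<integral>\<^sup>+z\<in>\<Omega>. ennreal (norm (g z) powr p * \<delta> z powr \<alpha>) \<partial>lborel)"
    by (rule norm_powr_le_nn_integral[OF assms(2,3)])
  define C3 where "C3 = 64 * 4 powr p * 2 powr (p + 2) * 2 powr \<bar>\<alpha> - 2\<bar> * pi"
  have C3: "0 \<le> C3" by (simp add: C3_def)
  \<comment> \<open>\<open>C1\<close> serves the left inequality; \<open>C2 + C3\<close> serves the
    right one, whose middle expression is a sum of two terms.\<close>
  define C where "C = max 1 (max C1 (C2 + C3))"
  show ?thesis
  proof (intro exI[of _ C] conjI allI impI)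
    show C_ge: "1 \<le> C" by (simp add: C_def)
    fix g :: "complex \<Rightarrow> complex" assume "g analytic_on \<Omega>"
    then have g: "g holomorphic_on \<Omega>" by (simp add: analytic_on_open open_\<Omega>)
    define I where "I = (\<integral>\<^sup>+z\<in>\<Omega>. ennreal (norm (g z) powr p * \<delta> z powr \<alpha>) \<partial>lborel)"
    define J where "J = ennreal (norm (g z0) powr p * \<delta> z0 powr (\<alpha> + 2)) +
         (\<integral>\<^sup>+z\<in>\<Omega>. ennreal (norm (deriv g z) powr p * \<delta> z powr (\<alpha> + p)) \<partial>lborel)"
    have "I \<le> ennreal C1 * J" unfolding I_def J_def by (rule C1(2)[rule_format, OF g])
    also have "\<dots> \<le> ennreal C * J" by (intro mult_right_mono ennreal_leI) (auto simp: C_def)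
    finally have "ennreal (inverse C) * I \<le> ennreal (inverse C) * (ennreal C * J)"
      by (rule mult_left_mono) simp
    also have "\<dots> = J"
      using C_ge by (simp add: mult.assoc[symmetric] ennreal_mult[symmetric])
    finally have 1: "ennreal (inverse C) * I \<le> J" .
    have "J \<le> ennreal C2 * I + ennreal C3 * I"
      unfolding J_def I_def C3_def by (intro add_mono C2(2)[rule_format] nn_integral_deriv_le g assms(3))
    also have "\<dots> = ennreal (C2 + C3) * I"
      using C2 C3 by (simp add: ennreal_plus distrib_right)
    also have "\<dots> \<le> ennreal C * I" by (intro mult_right_mono ennreal_leI) (auto simp: C_def)
    finally show "let I = set_nn_integral lborel \<Omega>
                 (\<lambda>z. ennreal (norm (g z) powr p * bdry_dist \<Omega> z powr \<alpha>));
           J = ennreal (norm (g z0) powr p * bdry_dist \<Omega> z0 powr (\<alpha> + 2))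
               + set_nn_integral lborel \<Omega>
                   (\<lambda>z. ennreal (norm (deriv g z) powr p * bdry_dist \<Omega> z powr (\<alpha> + p)))
       in ennreal (inverse C) * I \<le> J \<and> J \<le> ennreal C * I"
      using 1 by (simp add: I_def J_def)
  qed
qed

end
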